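(* In the setting described in the context, let $\hat u\in L^\infty(\Omega)$ be a weak solution of the balance law, with Helmholtz decomposition $\boldsymbol f(\hat u)=\nabla q+\nabla^\perp\psi$, $q\in H^1_{0,\Gamma_C}(\Omega)$, $\psi\in H^1_{0,\Gamma_I}(\Omega)$. Assume that there are constants $C>0$ and $\beta_{\hat u},\beta_q,\beta_\psi>0$, independent of $h$, such that for every $h$ there exist $\hat u^h\in\mathcal U^h$, $\hat q^h\in\mathcal V^h_{\Gamma_C}$, $\hat\psi^h\in\mathcal V^h_{\Gamma_I}$ with $$\|\hat u^h-\hat u\|\le C h^{\beta_{\hat u}}\|\hat u\|_{\beta_{\hat u}},\quad \|\nabla(\hat q^h-q)\|\le C h^{\beta_q}\|q\|_{\beta_q+1},\quad \|\nabla(\hat\psi^h-\psi)\|\le C h^{\beta_\psi}\|\psi\|_{\beta_\psi+1},$$ and that the $\hat u^h$ can be selected to form a bounded sequence in $L^\infty(\Omega)$ as $h\to0$. Assume that for every $h$ the functional $v^h\mapsto\mathcal G^h(v^h;q)$ has a minimizer $u^h$ over $\mathcal U^h$. Assume in addition that $$\lim_{h\to0}\|u^h-\tilde u\|=0$$ for some function $\tilde u\in L^\infty(\Omega)$, and that there is a constant $B>0$ such that $\|\tilde u\|_{L^\infty(\Omega)}\le B$ and $\|u^h\|_{L^\infty(\Omega)}\le B$ as $h\to0$. Then $\tilde u$ is a weak solution of the balance law, i.e. $$-(\boldsymbol f(\tilde u),\nabla\phi)=(r,\phi)-\langle\boldsymbol f(g)\cdot\boldsymbol n,\phi\rangle_\Gamma\qquad\text{for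 all }\phi\in H^1_{0,\Gamma_C}(\Omega).$$
   Context: **Domain and spaces.** $\Omega\subset\mathbb R^2$ (coordinates $(t,x)$) is open, bounded, simply connected with Lipschitz boundary $\Gamma$ and unit outward normal $\boldsymbol n$. $\nabla v=[\partial_t v,\partial_x v]$, $\nabla^\perp v=[\partial_x v,-\partial_t v]$. $\|\cdot\|$ and $(\cdot,\cdot)$ are the norm and inner product in $L^2(\Omega)$ and $[L^2(\Omega)]^2$; $\|\cdot\|_s$ is the norm of the Sobolev space $H^s(\Omega)$ (a bound involving $\|w\|_s$ implicitly presumes $w\in H^s(\Omega)$). $\Gamma=\overline{\Gamma_I}\cup\overline{\Gamma_C}$, where $\Gamma_I$ (the inflow part of the boundary, regarded as given) and $\Gamma_C$ are disjoint relatively open subcurves of nonzero measure with finitely many connected components. For $\Gamma_S\subset\Gamma$, $H^1_{0,\Gamma_S}(\Omega)=\{\phi\in H^1(\Omega):\phi=0\text{ on }\Gamma_S\}$ with norm $|\phi|_1=\|\nabla\phi\|$. **Helmholtz decomposition.** Every $\boldsymbol v\in[L^2(\Omega)]^2$ has a unique $L^2$-orthogonal decomposition $\boldsymbol v=\nabla q_{\boldsymbol v}+\nabla^\perp\psi_{\boldsymbol v}$ with $q_{\boldsymbol v}\in H^1_{0,\Gamma_C}(\Omega)$ and $\psi_{\boldsymbol v}\in H^1_{0,\Gamma_I}(\Omega)$, where $(\nabla q_{\boldsymbol v},\nabla\phi)=(\boldsymbol v,\nabla\phi)$ for all $\phi\in H^1_{0,\Gamma_C}(\Omega)$ and $(\nabla^\perp\psi_{\boldsymbol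 v},\nabla^\perp\nu)=(\boldsymbol v,\nabla^\perp\nu)$ for all $\nu\in H^1_{0,\Gamma_I}(\Omega)$. **Balance law.** $\nabla\cdot\boldsymbol f(u)=r$ in $\Omega$, $u=g$ on $\Gamma_I$, with $r\in L^2(\Omega)$, $g\in L^\infty(\Gamma_I)$, and $\boldsymbol f=[f_1,f_2]:\mathbb R\to\mathbb R^2$ locally Lipschitz: for every compact $J\subset\mathbb R$ there is $K_{\boldsymbol f,J}>0$ with $|f_i(a)-f_i(b)|\le K_{\boldsymbol f,J}|a-b|$ for $a,b\in J$, $i=1,2$. For $\phi\in H^1_{0,\Gamma_C}(\Omega)$, $\langle\boldsymbol f(g)\cdot\boldsymbol n,\phi\rangle_\Gamma=\int_{\Gamma_I}\boldsymbol f(g)\cdot\boldsymbol n\,\phi\,d\sigma$. A function $\hat u\in L^\infty(\Omega)$ is a weak solution if $-(\boldsymbol f(\hat u),\nabla\phi)=(r,\phi)-\langle\boldsymbol f(g)\cdot\boldsymbol n,\phi\rangle_\Gamma$ for all $\phi\in H^1_{0,\Gamma_C}(\Omega)$. **Functionals.** $h$ ranges over a sequence of positive mesh parameters tending to $0$; for each $h$, $\mathcal U^h\subset L^\infty(\Omega)$, $\mathcal V^h_{\Gamma_C}\subset H^1_{0,\Gamma_C}(\Omega)$, $\mathcal V^h_{\Gamma_I}\subset H^1_{0,\Gamma_I}(\Omega)$ are (finite-dimensional) finite element spaces. For $v\in L^\infty(\Omega)$, $p\in H^1_{0,\Gamma_C}(\Omega)$, $\mu\in H^1_{0,\Gamma_I}(\Omega)$,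 $$\mathcal F(v,p,\mu;q)=\|\boldsymbol f(v)-\nabla p-\nabla^\perp\mu\|^2+\|\nabla p-\nabla q\|^2,\qquad \mathcal G^h(v;q)=\min_{p^h\in\mathcal V^h_{\Gamma_C},\,\mu^h\in\mathcal V^h_{\Gamma_I}}\mathcal F(v,p^h,\mu^h;q).$$ *)

theory Defs
  imports "HOL-Analysis.Analysis" "HOL-Probability.Essential_Supremum"
begin

text \<open>Points of the plane are pairs \<open>(t, x)\<close>. Functions on \<open>\<Omega>\<close> are total functions of which
  only the values on \<open>\<Omega>\<close> matter, up to null sets of \<^term>\<open>lebesgue_on \<Omega>\<close>.\<close>

type_synonym plane = "real \<times> real"


subsection \<open>Lebesgue spaces\<close>

definition L2 :: "'a measure \<Rightarrow> ('a \<Rightarrow> 'b::euclidean_space) set" where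
  "L2 M = {v \<in> borel_measurable M. integrable M (\<lambda>x. (norm (v x))\<^sup>2)}"

definition L2_inner :: "'a measure \<Rightarrow> ('a \<Rightarrow> 'b::euclidean_space) \<Rightarrow> ('a \<Rightarrow> 'b) \<Rightarrow> real" where
  "L2_inner M v w = (LINT x|M. v x \<bullet> w x)"

definition L2_norm :: "'a measure \<Rightarrow> ('a \<Rightarrow> 'b::euclidean_space) \<Rightarrow> real" where
  "L2_norm M v = sqrt (LINT x|M. (norm (v x))\<^sup>2)"

definition Linf_norm :: "'a measure \<Rightarrow> ('a \<Rightarrow> real) \<Rightarrow> ereal" where
  "Linf_norm M v = esssup M (\<lambda>x. ereal \<bar>v x\<bar>)"

definition Linf :: "'a measure \<Rightarrow> ('a \<Rightarrow> real) set" where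
  "Linf M = {v \<in> borel_measurable M. Linf_norm M v < \<infinity>}"


subsection \<open>Weak derivatives and Sobolev spaces\<close>

definition part_t :: "(plane \<Rightarrow> real) \<Rightarrow> plane \<Rightarrow> real" where
  "part_t v = (\<lambda>p. deriv (\<lambda>s. v (s, snd p)) (fst p))"

definition part_x :: "(plane \<Rightarrow> real) \<Rightarrow> plane \<Rightarrow> real" where
  "part_x v = (\<lambda>p. deriv (\<lambda>s. v (fst p, s)) (snd p))"

definition mixed_part :: "nat \<Rightarrow> nat \<Rightarrow> (plane \<Rightarrow> real) \<Rightarrow> plane \<Rightarrow> real" where
  "mixed_part i j v = (part_t ^^ i) ((part_x ^^ j) v)"

text \<open>If all the iterated partial derivatives taken in this one order are (totally)
  differentiable, then the order is irrelevant and the function is infinitely often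
  continuously differentiable.\<close>

definition smooth :: "(plane \<Rightarrow> real) \<Rightarrow> bool" where
  "smooth v \<longleftrightarrow> (\<forall>i j. mixed_part i j v differentiable_on UNIV)"

definition test_functions :: "plane set \<Rightarrow> (plane \<Rightarrow> real) set" where
  "test_functions \<Omega> = {\<eta>. smooth \<eta> \<and> compact (closure {p. \<eta> p \<noteq> 0}) \<and> closure {p. \<eta> p \<noteq> 0} \<subseteq> \<Omega>}"

definition is_weak_deriv ::
    "plane set \<Rightarrow> nat \<Rightarrow> nat \<Rightarrow> (plane \<Rightarrow> real) \<Rightarrow> (plane \<Rightarrow> real) \<Rightarrow> bool" where
  "is_weak_deriv \<Omega> i j v w \<longleftrightarrow>
     w \<in> L2 (lebesgue_on \<Omega>) \<and>
     (\<forall>\<eta>\<in>test_functions \<Omega>. (LINT p|lebesgue_on \<Omega>. v p * mixed_part i j \<eta> p)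
        = (-1) ^ (i + j) * (LINT p|lebesgue_on \<Omega>. w p * \<eta> p))"

definition wderiv :: "plane set \<Rightarrow> nat \<Rightarrow> nat \<Rightarrow> (plane \<Rightarrow> real) \<Rightarrow> plane \<Rightarrow> real" where
  "wderiv \<Omega> i j v = (SOME w. is_weak_deriv \<Omega> i j v w)"

definition Hm :: "plane set \<Rightarrow> nat \<Rightarrow> (plane \<Rightarrow> real) set" where
  "Hm \<Omega> m = {v \<in> L2 (lebesgue_on \<Omega>). \<forall>i j. i + j \<le> m \<longrightarrow> (\<exists>w. is_weak_deriv \<Omega> i j v w)}"

text \<open>\<open>H\<^sup>s(\<Omega>)\<close> for real \<open>s \<ge> 0\<close> with the Sobolev-Slobodeckij norm:
  \<open>s = m + \<theta>\<close> with \<open>m\<close> integer and \<open>0 \<le> \<theta> < 1\<close>; for \<open>\<theta> > 0\<close> the Gagliardo seminorms of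
  the derivatives of order \<open>m\<close> are added (the exponent is \<open>d + 2 \<theta>\<close> in dimension \<open>d = 2\<close>).\<close>

definition Hs_norm_sq :: "plane set \<Rightarrow> real \<Rightarrow> (plane \<Rightarrow> real) \<Rightarrow> ennreal" where
  "Hs_norm_sq \<Omega> s v =
     (let m = nat \<lfloor>s\<rfloor>; \<theta> = s - real m in
       (\<Sum>(i, j)\<in>{(i, j). i + j \<le> m}.
          \<integral>\<^sup>+p. ennreal ((wderiv \<Omega> i j v p)\<^sup>2) \<partial>lebesgue_on \<Omega>)
       + (if \<theta> = 0 then 0 else
           (\<Sum>(i, j)\<in>{(i, j). i + j = m}.
              \<integral>\<^sup>+p. (\<integral>\<^sup>+p'. ennreal ((wderiv \<Omega> i j v p - wderiv \<Omega> i j v p')\<^sup>2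
                                  / (norm (p - p')) powr (2 + 2 * \<theta>))
                   \<partial>lebesgue_on \<Omega>) \<partial>lebesgue_on \<Omega>)))"

definition Hs :: "plane set \<Rightarrow> real \<Rightarrow> (plane \<Rightarrow> real) set" where
  "Hs \<Omega> s = {v \<in> Hm \<Omega> (nat \<lfloor>s\<rfloor>). Hs_norm_sq \<Omega> s v < \<infinity>}"

definition Hs_norm :: "plane set \<Rightarrow> real \<Rightarrow> (plane \<Rightarrow> real) \<Rightarrow> real" where
  "Hs_norm \<Omega> s v = sqrt (enn2real (Hs_norm_sq \<Omega> s v))"

definition grad :: "plane set \<Rightarrow> (plane \<Rightarrow> real) \<Rightarrow> plane \<Rightarrow> plane" where
  "grad \<Omega> v = (\<lambda>p. (wderiv \<Omega> 1 0 v p, wderiv \<Omega> 0 1 v p))"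

definition grad_perp :: "plane set \<Rightarrow> (plane \<Rightarrow> real) \<Rightarrow> plane \<Rightarrow> plane" where
  "grad_perp \<Omega> v = (\<lambda>p. (wderiv \<Omega> 0 1 v p, - wderiv \<Omega> 1 0 v p))"


subsection \<open>Boundary: Lipschitz domains, arc length and the outward normal\<close>

text \<open>In suitable Cartesian coordinates \<open>(a, b)\<close> centred at any boundary point, \<open>\<Omega>\<close> is locally
  the epigraph of a Lipschitz function. The frontier is then locally its graph.\<close>

definition lipschitz_boundary :: "plane set \<Rightarrow> bool" where
  "lipschitz_boundary \<Omega> \<longleftrightarrow>
     (\<forall>p\<in>frontier \<Omega>. \<exists>e1 e2 (\<gamma>::real \<Rightarrow> real) L r s.
        norm e1 = 1 \<and> norm e2 = 1 \<and> e1 \<bullet> e2 = 0 \<and> r > 0 \<and> s > 0 \<and>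
        L-lipschitz_on {-r..r} \<gamma> \<and>
        (\<forall>a b. \<bar>a\<bar> < r \<and> \<bar>b\<bar> < s \<longrightarrow> (p + a *\<^sub>R e1 + b *\<^sub>R e2 \<in> \<Omega> \<longleftrightarrow> \<gamma> a < b)))"

definition hausdorff1_pre :: "real \<Rightarrow> plane set \<Rightarrow> ennreal" where
  "hausdorff1_pre \<delta> A =
     (INF C\<in>{C::nat \<Rightarrow> plane set. A \<subseteq> (\<Union>i. C i) \<and> (\<forall>i. bounded (C i) \<and> diameter (C i) \<le> \<delta>)}.
        \<Sum>i. ennreal (diameter (C i)))"

definition hausdorff1_outer :: "plane set \<Rightarrow> ennreal" where
  "hausdorff1_outer A = (SUP \<delta>\<in>{0<..}. hausdorff1_pre \<delta> A)"

text \<open>One-dimensional Hausdorff measure on its Caratheodory-measurable sets; on a Lipschitz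
  curve this is arc length.\<close>

definition hausdorff1 :: "plane measure" where
  "hausdorff1 =
     measure_of UNIV (lambda_system UNIV (Pow UNIV) hausdorff1_outer) hausdorff1_outer"

abbreviation arc_length_on :: "plane set \<Rightarrow> plane measure" where
  "arc_length_on S \<equiv> restrict_space hausdorff1 S"

text \<open>Near \<open>p\<close>, every cone around \<open>-\<nu>\<close> of opening less than a half-plane lies in \<open>\<Omega>\<close> and its
  mirror image outside. On a Lipschitz boundary such a \<open>\<nu>\<close> exists at almost every point,
  namely wherever the local graph has a tangent, and it is unique.\<close>

definition is_outer_normal :: "plane set \<Rightarrow> plane \<Rightarrow> plane \<Rightarrow> bool" where
  "is_outer_normal \<Omega> p \<nu> \<longleftrightarrow>
     norm \<nu> = 1 \<and>
     (\<forall>\<epsilon>>0. \<exists>\<rho>>0. \<forall>y. norm (y - p) < \<rho> \<longrightarrow>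
        ((y - p) \<bullet> \<nu> < - \<epsilon> * norm (y - p) \<longrightarrow> y \<in> \<Omega>) \<and>
        ((y - p) \<bullet> \<nu> > \<epsilon> * norm (y - p) \<longrightarrow> y \<notin> \<Omega>))"

definition outer_normal :: "plane set \<Rightarrow> plane \<Rightarrow> plane" where
  "outer_normal \<Omega> p = (THE \<nu>. is_outer_normal \<Omega> p \<nu>)"


subsection \<open>Boundary values of Sobolev functions\<close>

definition smooth_approx :: "plane set \<Rightarrow> (plane \<Rightarrow> real) \<Rightarrow> (nat \<Rightarrow> plane \<Rightarrow> real) \<Rightarrow> bool" where
  "smooth_approx \<Omega> v \<Phi> \<longleftrightarrow>
     (\<forall>n. smooth (\<Phi> n)) \<and>
     (\<lambda>n. L2_norm (lebesgue_on \<Omega>) (\<lambda>p. \<Phi> n p - v p)) \<longlonglongrightarrow> 0 \<and>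
     (\<lambda>n. L2_norm (lebesgue_on \<Omega>) (\<lambda>p. (part_t (\<Phi> n) p, part_x (\<Phi> n) p) - grad \<Omega> v p))
        \<longlonglongrightarrow> 0"

text \<open>The trace is the continuous extension of the restriction map
  \<open>\<Phi> \<mapsto> \<Phi>|\<Gamma>\<close> from functions smooth up to the boundary to \<open>H\<^sup>1(\<Omega>) \<rightarrow> L\<^sup>2(\<Gamma>)\<close>.\<close>

definition is_trace :: "plane set \<Rightarrow> (plane \<Rightarrow> real) \<Rightarrow> (plane \<Rightarrow> real) \<Rightarrow> bool" where
  "is_trace \<Omega> v w \<longleftrightarrow>
     w \<in> L2 (arc_length_on (frontier \<Omega>)) \<and>
     (\<exists>\<Phi>. smooth_approx \<Omega> v \<Phi> \<and>
        (\<lambda>n. L2_norm (arc_length_on (frontier \<Omega>)) (\<lambda>p. \<Phi> n p - w p)) \<longlonglongrightarrow> 0)"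

definition bdry_trace :: "plane set \<Rightarrow> (plane \<Rightarrow> real) \<Rightarrow> plane \<Rightarrow> real" where
  "bdry_trace \<Omega> v = (SOME w. is_trace \<Omega> v w)"

text \<open>\<open>v = 0\<close> on \<open>S\<close> in the sense of \<open>H\<^sup>1(\<Omega>)\<close>: \<open>v\<close> is the \<open>H\<^sup>1\<close>-limit of functions that are smooth
  up to the boundary and vanish on \<open>S\<close>. For a Lipschitz domain and \<open>S\<close> a union of finitely many
  arcs of its boundary this is the same as the trace being zero almost everywhere on \<open>S\<close>.\<close>

definition zero_on_boundary_part :: "plane set \<Rightarrow> plane set \<Rightarrow> (plane \<Rightarrow> real) \<Rightarrow> bool" where
  "zero_on_boundary_part \<Omega> S v \<longleftrightarrow> (\<exists>\<Phi>. smooth_approx \<Omega> v \<Phi> \<and> (\<forall>n. \<forall>p\<in>S. \<Phi> n p = 0))"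

definition H1_zero :: "plane set \<Rightarrow> plane set \<Rightarrow> (plane \<Rightarrow> real) set" where
  "H1_zero \<Omega> S = {v \<in> Hm \<Omega> 1. zero_on_boundary_part \<Omega> S v}"


subsection \<open>The balance law\<close>

definition locally_lipschitz_flux :: "(real \<Rightarrow> plane) \<Rightarrow> bool" where
  "locally_lipschitz_flux f \<longleftrightarrow>
     (\<forall>J. compact J \<longrightarrow> (\<exists>K>0. \<forall>a\<in>J. \<forall>b\<in>J.
        \<bar>fst (f a) - fst (f b)\<bar> \<le> K * \<bar>a - b\<bar> \<and> \<bar>snd (f a) - snd (f b)\<bar> \<le> K * \<bar>a - b\<bar>))"

definition inflow_pairing ::
    "plane set \<Rightarrow> plane set \<Rightarrow> (real \<Rightarrow> plane) \<Rightarrow> (plane \<Rightarrow> real) \<Rightarrow> (plane \<Rightarrow> real) \<Rightarrow> real" where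
  "inflow_pairing \<Omega> \<Gamma>I f g \<phi> =
     (LINT p|arc_length_on \<Gamma>I. (f (g p) \<bullet> outer_normal \<Omega> p) * bdry_trace \<Omega> \<phi> p)"

definition weak_solution ::
    "plane set \<Rightarrow> plane set \<Rightarrow> plane set \<Rightarrow> (real \<Rightarrow> plane) \<Rightarrow> (plane \<Rightarrow> real) \<Rightarrow> (plane \<Rightarrow> real)
      \<Rightarrow> (plane \<Rightarrow> real) \<Rightarrow> bool" where
  "weak_solution \<Omega> \<Gamma>I \<Gamma>C f r g u \<longleftrightarrow>
     u \<in> Linf (lebesgue_on \<Omega>) \<and>
     (\<forall>\<phi>\<in>H1_zero \<Omega> \<Gamma>C.
        - L2_inner (lebesgue_on \<Omega>) (\<lambda>p. f (u p)) (grad \<Omega> \<phi>)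
          = L2_inner (lebesgue_on \<Omega>) r \<phi> - inflow_pairing \<Omega> \<Gamma>I f g \<phi>)"


subsection \<open>The least-squares functionals\<close>

definition finite_dim_space :: "(plane \<Rightarrow> real) set \<Rightarrow> bool" where
  "finite_dim_space V \<longleftrightarrow>
     (\<exists>(n::nat) b. V = range (\<lambda>c::nat \<Rightarrow> real. \<lambda>p. \<Sum>i<n. c i * b i p))"

definition F_functional ::
    "plane set \<Rightarrow> (real \<Rightarrow> plane) \<Rightarrow> (plane \<Rightarrow> real) \<Rightarrow> (plane \<Rightarrow> real) \<Rightarrow> (plane \<Rightarrow> real)
      \<Rightarrow> (plane \<Rightarrow> real) \<Rightarrow> real" where
  "F_functional \<Omega> f v p \<mu> q =
     (L2_norm (lebesgue_on \<Omega>) (\<lambda>x. f (v x) - grad \<Omega> p x - grad_perp \<Omega> \<mu> x))\<^sup>2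
     + (L2_norm (lebesgue_on \<Omega>) (\<lambda>x. grad \<Omega> p x - grad \<Omega> q x))\<^sup>2"

text \<open>For finite-dimensional \<open>VC\<close>, \<open>VI\<close> the infimum is attained, since \<^const>\<open>F_functional\<close> is a
  nonnegative quadratic function of the coefficients of \<open>p\<close> and \<open>\<mu>\<close>; it is the minimum.\<close>

definition G_functional ::
    "plane set \<Rightarrow> (real \<Rightarrow> plane) \<Rightarrow> (plane \<Rightarrow> real) set \<Rightarrow> (plane \<Rightarrow> real) set \<Rightarrow> (plane \<Rightarrow> real)
      \<Rightarrow> (plane \<Rightarrow> real) \<Rightarrow> real" where
  "G_functional \<Omega> f VC VI v q = (INF (p, \<mu>)\<in>VC \<times> VI. F_functional \<Omega> f v p \<mu> q)"

end

(* The Helmholtz orthogonality (grad_perp mu, grad phi) = 0, for mu = 0 on Gamma_I and phi = 0 on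
   Gamma_C, reduces by density to smooth M and Phi whose product vanishes on the frontier. Composing
   both with a cutoff that vanishes near 0 makes the Jacobian of (M, Phi) the divergence of a field
   that is zero near the frontier, so its integral is 0 by Fubini; removing the cutoff costs nothing
   because the gradient of a smooth function vanishes almost everywhere on its zero set.

   Comparing the minimizers with the approximants of the exact solution, the minimal functional
   values tend to 0. Hence f(u_h) is L2-close to grad p_h + grad_perp mu_h with grad p_h -> grad q;
   tested against grad phi the rotated gradients drop out, so f(util) and f(uhat) have the same
   inner products with grad phi. *)
theory Submission
  imports Defs "HOL-Real_Asymp.Real_Asymp"
begin

subsection \<open>Calculus in the plane\<close>

text \<open>In the classical argument, integration by parts leaves a boundary integral of
  \<open>M\<close> times the tangential derivative of \<open>\<Phi>\<close>, which is zero because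
  on each part of the frontier \<open>M\<close> vanishes or \<open>\<Phi>\<close> is constant.
  Working with traces, normals and a divergence theorem is avoided by a cutoff of level
  \<open>c\<close>; the price is that its derivatives grow with \<open>c\<close>. Two facts tame
  them. For \<open>M\<close> the derivative occurs only in the scale-invariant form
  \<open>c * M * cutoff_deriv (c * M)\<close>, which is bounded independently of \<open>c\<close>.
  For \<open>\<Phi>\<close> it multiplies the Jacobian of \<open>\<Phi>\<close> with itself, which
  is 0. This dictates the asymmetric roles of the two cutoffs. The nonlinear \<open>f\<close> passes
  to the limit because common essential bounds confine all values to one compact interval, where
  \<open>f\<close> is Lipschitz. The data \<open>r\<close> and \<open>g\<close> enter only through
  the equation of the exact solution: the right-hand side of the weak form does not contain the
  solution, so comparing the left-hand sides is enough.\<close>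

lemma has_derivative_parts:
  fixes v :: "plane \<Rightarrow> real"
  assumes "v differentiable at p"
  shows "(v has_derivative (\<lambda>h. fst h * part_t v p + snd h * part_x v p)) (at p)"
    and "((\<lambda>s. v (s, snd p)) has_real_derivative part_t v p) (at (fst p))"
    and "((\<lambda>s. v (fst p, s)) has_real_derivative part_x v p) (at (snd p))"
proof -
  obtain D where D: "(v has_derivative D) (at p)"
    using assms by (auto simp: differentiable_def)
  then have D': "(v has_derivative D) (at (fst p, snd p))" by simp
  have lin: "linear D" using D by (simp add: has_derivative_linear)
  have t: "((\<lambda>s. v (s, snd p)) has_derivative (\<lambda>h. D (h, 0))) (at (fst p))"
    by (rule has_derivative_compose[where f = "\<lambda>s. (s, snd p)" and f' = "\<lambda>h. (h, 0)", OF _ D'])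
       (auto intro!: derivative_eq_intros)
  have x: "((\<lambda>s. v (fst p, s)) has_derivative (\<lambda>h. D (0, h))) (at (snd p))"
    by (rule has_derivative_compose[where f = "\<lambda>s. (fst p, s)" and f' = "\<lambda>h. (0, h)", OF _ D'])
       (auto intro!: derivative_eq_intros)
  have Dt: "D (h, 0) = D (1, 0) * h" for h
    using linear_scale[OF lin, of h "(1, 0)"] by simp
  have Dx: "D (0, h) = D (0, 1) * h" for h
    using linear_scale[OF lin, of h "(0, 1)"] by simp
  have t': "((\<lambda>s. v (s, snd p)) has_real_derivative D (1, 0)) (at (fst p))"
    using t unfolding has_field_derivative_def by (subst (asm) Dt)
  have x': "((\<lambda>s. v (fst p, s)) has_real_derivative D (0, 1)) (at (snd p))"
    using x unfolding has_field_derivative_def by (subst (asm) Dx)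
  have et: "part_t v p = D (1, 0)" and ex: "part_x v p = D (0, 1)"
    unfolding part_t_def part_x_def using t' x' by (auto intro: DERIV_imp_deriv)
  have "D h = fst h * part_t v p + snd h * part_x v p" for h
  proof -
    have "D h = D ((fst h, 0) + (0, snd h))" by simp
    also have "\<dots> = D (fst h, 0) + D (0, snd h)" using lin by (rule linear_add)
    finally show ?thesis using Dt[of "fst h"] Dx[of "snd h"] et ex by (simp add: mult.commute)
  qed
  then have "D = (\<lambda>h. fst h * part_t v p + snd h * part_x v p)" by auto
  then show "(v has_derivative (\<lambda>h. fst h * part_t v p + snd h * part_x v p)) (at p)"
    using D by simp
  show "((\<lambda>s. v (s, snd p)) has_real_derivative part_t v p) (at (fst p))"
    and "((\<lambda>s. v (fst p, s)) has_real_derivative part_x v p) (at (snd p))"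
    using t' x' et ex by auto
qed

text \<open>\<open>smooth\<close> speaks only of derivatives with the t-derivatives applied last, so
  the other order must be derived. Writing increments of \<open>v\<close> in x as integrals of
  \<open>part_x v\<close> and differentiating under the integral in t expresses
  \<open>part_t v\<close> as a constant plus an integral of \<open>part_t (part_x v)\<close>;
  differentiating that in x gives the claim.\<close>

lemma part_commute:
  fixes v :: "plane \<Rightarrow> real"
  assumes v: "\<And>p. v differentiable at p" "\<And>p. part_t v differentiable at p"
      "\<And>p. part_x v differentiable at p"
    and cont: "continuous_on UNIV (part_t (part_x v))"
  shows "part_x (part_t v) = part_t (part_x v)"
proof
  fix p :: plane
  obtain t0 x0 where p: "p = (t0, x0)" by fastforce
  \<comment> \<open>Any base point strictly left of \<open>x0\<close> would do: \<open>x0\<close> is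
    then interior, and the derivative of the integral from \<open>c\<close> is two-sided
    there.\<close>
  define c where "c = x0 - 1"
  have contx: "continuous_on UNIV (part_x v)"
    using v(3) by (simp add: differentiable_imp_continuous_on differentiable_on_def
        differentiable_at_withinI)
  have FTC: "integral {c..x} (\<lambda>y. part_x v (t, y)) = v (t, x) - v (t, c)" if "c \<le> x" for t x
    by (rule integral_unique, rule fundamental_theorem_of_calculus[OF that])
       (use has_derivative_parts(3)[OF v(1), of "(t, _)"] in
         \<open>auto simp flip: has_real_derivative_iff_has_vector_derivative
           intro: has_field_derivative_at_within\<close>)
  have part_t_eq: "part_t v (t0, x) = part_t v (t0, c) + integral {c..x} (\<lambda>y. part_t (part_x v) (t0, y))"
    if "c \<le> x" for x
  proof -
    have "((\<lambda>t. integral (cbox c x) (\<lambda>y. part_x v (t, y))) has_field_derivative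
        integral (cbox c x) (\<lambda>y. part_t (part_x v) (t0, y))) (at t0 within UNIV)"
    proof (rule leibniz_rule_field_derivative)
      show "((\<lambda>t. part_x v (t, y)) has_field_derivative part_t (part_x v) (t, y)) (at t within UNIV)"
        for t y using has_derivative_parts(2)[OF v(3), of "(t, y)"] by simp
      show "(\<lambda>y. part_x v (t, y)) integrable_on cbox c x" for t
        by (rule integrable_continuous)
           (auto intro!: continuous_on_compose2[OF contx] continuous_intros)
      show "continuous_on (UNIV \<times> cbox c x) (\<lambda>(t, y). part_t (part_x v) (t, y))"
        using cont by (simp add: continuous_on_subset[OF cont])
    qed auto
    then have "((\<lambda>t. v (t, x) - v (t, c)) has_real_derivative
        integral {c..x} (\<lambda>y. part_t (part_x v) (t0, y))) (at t0)"
      by (simp add: FTC[OF that])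
    moreover have "((\<lambda>t. v (t, x) - v (t, c)) has_real_derivative
        part_t v (t0, x) - part_t v (t0, c)) (at t0)"
      using has_derivative_parts(2)[OF v(1), of "(t0, x)"]
        has_derivative_parts(2)[OF v(1), of "(t0, c)"] by (auto intro!: derivative_intros)
    ultimately show ?thesis using DERIV_unique by fastforce
  qed
  have "((\<lambda>x. integral {c..x} (\<lambda>y. part_t (part_x v) (t0, y))) has_real_derivative
      part_t (part_x v) (t0, x0)) (at x0 within {c..x0 + 1})"
    by (rule integral_has_real_derivative)
       (auto simp: c_def intro!: continuous_on_compose2[OF cont] continuous_intros)
  then have "((\<lambda>x. integral {c..x} (\<lambda>y. part_t (part_x v) (t0, y))) has_real_derivative
      part_t (part_x v) (t0, x0)) (at x0)"
    by (subst (asm) at_within_interior) (auto simp: c_def)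
  from DERIV_add[OF DERIV_const this]
  have "((\<lambda>x. part_t v (t0, c) + integral {c..x} (\<lambda>y. part_t (part_x v) (t0, y)))
      has_real_derivative part_t (part_x v) (t0, x0)) (at x0)" by simp
  then have "((\<lambda>x. part_t v (t0, x)) has_real_derivative part_t (part_x v) (t0, x0)) (at x0)"
    by (rule has_field_derivative_transform_within_open[where S = "{c<..}"])
       (auto simp: c_def intro: part_t_eq[symmetric, unfolded c_def])
  moreover have "((\<lambda>x. part_t v (t0, x)) has_real_derivative part_x (part_t v) (t0, x0)) (at x0)"
    using has_derivative_parts(3)[OF v(2), of "(t0, x0)"] by simp
  ultimately show "part_x (part_t v) p = part_t (part_x v) p"
    unfolding p using DERIV_unique by blast
qed

lemma smoothD:
  assumes "smooth v"
  shows "v differentiable at p" "part_t v differentiable at p" "part_x v differentiable at p"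
    "continuous_on UNIV v" "continuous_on UNIV (part_t v)" "continuous_on UNIV (part_x v)"
    "continuous_on UNIV (part_t (part_x v))" "part_x (part_t v) = part_t (part_x v)"
proof -
  have *: "mixed_part i j v differentiable_on UNIV" for i j
    using assms by (simp add: smooth_def)
  show d: "v differentiable at p" "part_t v differentiable at p" "part_x v differentiable at p" for p
    using *[of 0 0] *[of 1 0] *[of 0 1]
    by (simp_all add: mixed_part_def differentiable_on_def del: split_paired_All)
  show "continuous_on UNIV v" "continuous_on UNIV (part_t v)" "continuous_on UNIV (part_x v)"
    and c: "continuous_on UNIV (part_t (part_x v))"
    using *[of 0 0] *[of 1 0] *[of 0 1] *[of 1 1]
    by (auto simp: mixed_part_def dest: differentiable_imp_continuous_on)
  show "part_x (part_t v) = part_t (part_x v)"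
    using d c by (rule part_commute)
qed

section \<open>Derivatives of functions that vanish far out, or near the frontier, integrate to
  zero\<close>

lemma integral_deriv_compact_support:
  fixes g g' :: "real \<Rightarrow> real"
  assumes der: "\<And>s. (g has_real_derivative g' s) (at s)" and cont: "continuous_on UNIV g'"
    and supp: "\<And>s. \<bar>s\<bar> \<ge> R \<Longrightarrow> g s = 0"
  shows "integral\<^sup>L lborel g' = 0"
proof -
  \<comment> \<open>Strictly beyond \<open>R\<close>, so that \<open>g\<close> vanishes at both end
    points and on the whole open set outside them; the absolute value covers a negative
    \<open>R\<close>.\<close>
  define R' where "R' = \<bar>R\<bar> + 1"
  have zero: "g' s = 0" if "\<bar>s\<bar> > R'" for s
  proof -
    have "(g has_real_derivative 0) (at s)"
      by (rule has_field_derivative_transform_within_open[where f = "\<lambda>_. 0" and S = "- {-R'..R'}"])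
         (use that supp in \<open>auto simp: R'_def\<close>)
    then show ?thesis using der DERIV_unique by blast
  qed
  have "(\<integral>x. g' x * indicator {-R'..R'} x \<partial>lborel) = g R' - g (-R')"
    by (rule integral_FTC_Icc_real)
       (use der cont in \<open>auto simp: R'_def continuous_on_eq_continuous_at\<close>)
  also have "\<dots> = 0" using supp by (simp add: R'_def)
  also have "(\<lambda>x. g' x * indicator {-R'..R'} x) = g'"
  proof
    show "g' x * indicator {-R'..R'} x = g' x" for x
      using zero[of x] by (cases "\<bar>x\<bar> > R'") (auto simp: indicator_def)
  qed
  finally show ?thesis .
qed

lemma integrable_compact_support:
  fixes F :: "'a::euclidean_space \<Rightarrow> real"
  assumes "continuous_on UNIV F" and "\<And>p. norm p > R \<Longrightarrow> F p = 0"
  shows "integrable lborel F"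
proof -
  have "integrable lborel (\<lambda>x. indicator (cball 0 R) x *\<^sub>R F x)"
    by (rule borel_integrable_compact) (auto intro: continuous_on_subset[OF assms(1)])
  also have "(\<lambda>x. indicator (cball 0 R) x *\<^sub>R F x) = F"
    using assms(2) by (auto simp: indicator_def fun_eq_iff not_le)
  finally show ?thesis .
qed

text \<open>Fubini, with the inner integral taken along lines parallel to \<open>e\<close>, where
  the fundamental theorem gives 0. Continuity is asked of the derivative along \<open>e\<close>
  alone: for a field built from first derivatives of a smooth function this involves only the mixed
  second derivative.\<close>

lemma integral_directional_deriv_compact_support:
  fixes w :: "plane \<Rightarrow> real"
  assumes der: "\<And>p. (w has_derivative F p) (at p)"
    and e: "e = (1, 0) \<or> e = (0, 1)"
    and cont: "continuous_on UNIV (\<lambda>p. F p e)"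
    and supp: "\<And>p. norm p > R \<Longrightarrow> w p = 0"
  shows "integrable lborel (\<lambda>p. F p e)" "(\<integral>p. F p e \<partial>lborel) = 0"
proof -
  have F0: "F p = (\<lambda>h. 0)" if "norm p > R" for p
  proof -
    have "(w has_derivative (\<lambda>h. 0)) (at p)"
      by (rule has_derivative_transform_within_open[where f = "\<lambda>_. 0" and s = "- cball 0 R"])
         (use that supp in \<open>auto simp: not_le\<close>)
    then show ?thesis by (rule has_derivative_unique[OF der])
  qed
  show int: "integrable lborel (\<lambda>p. F p e)"
    by (rule integrable_compact_support[OF cont, where R = R], drule F0, simp)
  have F_scale: "F p (c *\<^sub>R h) = F p h * c" for p h c
    using linear_scale[OF has_derivative_linear[OF der]] by simp
  have slice: "norm (t, x) > R" if "\<bar>t\<bar> \<ge> \<bar>R\<bar> + 1 \<or> \<bar>x\<bar> \<ge> \<bar>R\<bar> + 1" for t x :: real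
    using that norm_fst_le[of t x] norm_snd_le[of x t] by auto
  have int': "integrable (lborel \<Otimes>\<^sub>M lborel) (\<lambda>(x, y). F (x, y) e)"
    using int by (simp add: lborel_prod case_prod_unfold)
  from e show "(\<integral>p. F p e \<partial>lborel) = 0"
  proof
    assume [simp]: "e = (1, 0)"
    have "(\<integral>t. F (t, x) e \<partial>lborel) = 0" for x
    proof (rule integral_deriv_compact_support[where g = "\<lambda>t. w (t, x)" and R = "\<bar>R\<bar> + 1"])
      show "((\<lambda>t. w (t, x)) has_real_derivative F (t, x) e) (at t)" for t
      proof -
        have "((\<lambda>t. w (t, x)) has_derivative (\<lambda>h. F (t, x) (h, 0))) (at t)"
          by (rule has_derivative_compose[where f = "\<lambda>t. (t, x)" and f' = "\<lambda>h. (h, 0)", OF _ der])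
             (auto intro!: derivative_eq_intros)
        moreover have "(\<lambda>h. F (t, x) (h, 0)) = (*) (F (t, x) e)"
          using F_scale[of "(t, x)" _ e, symmetric] by (intro ext) simp
        ultimately show ?thesis by (simp add: has_field_derivative_def)
      qed
      show "continuous_on UNIV (\<lambda>t. F (t, x) e)"
        by (rule continuous_on_compose2[OF cont]) (auto intro!: continuous_intros)
      show "w (t, x) = 0" if "\<bar>t\<bar> \<ge> \<bar>R\<bar> + 1" for t
        using slice supp that by simp
    qed
    then show ?thesis
      using lborel_pair.integral_snd[OF int'] by (simp add: lborel_prod case_prod_unfold)
  next
    assume [simp]: "e = (0, 1)"
    have "(\<integral>x. F (t, x) e \<partial>lborel) = 0" for t
    proof (rule integral_deriv_compact_support[where g = "\<lambda>x. w (t, x)" and R = "\<bar>R\<bar> + 1"])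
      show "((\<lambda>x. w (t, x)) has_real_derivative F (t, x) e) (at x)" for x
      proof -
        have "((\<lambda>x. w (t, x)) has_derivative (\<lambda>h. F (t, x) (0, h))) (at x)"
          by (rule has_derivative_compose[where f = "\<lambda>x. (t, x)" and f' = "\<lambda>h. (0, h)", OF _ der])
             (auto intro!: derivative_eq_intros)
        moreover have "(\<lambda>h. F (t, x) (0, h)) = (*) (F (t, x) e)"
          using F_scale[of "(t, x)" _ e, symmetric] by (intro ext) simp
        ultimately show ?thesis by (simp add: has_field_derivative_def)
      qed
      show "continuous_on UNIV (\<lambda>x. F (t, x) e)"
        by (rule continuous_on_compose2[OF cont]) (auto intro!: continuous_intros)
      show "w (t, x) = 0" if "\<bar>x\<bar> \<ge> \<bar>R\<bar> + 1" for x
        using slice supp that by simp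
    qed
    then show ?thesis
      using lborel_pair.integral_fst[OF int'] by (simp add: lborel_prod case_prod_unfold)
  qed
qed

text \<open>Extension by zero outside \<open>\<Omega>\<close> reduces this to the whole plane. The
  extension is differentiable everywhere because it agrees with \<open>w\<close> on the open set
  \<open>\<Omega>\<close> and is 0 on an open set containing everything else.\<close>

lemma integral_directional_deriv_zero_near_frontier:
  fixes w :: "plane \<Rightarrow> real"
  assumes der: "\<And>p. (w has_derivative F p) (at p)"
    and e: "e = (1, 0) \<or> e = (0, 1)"
    and cont: "continuous_on UNIV (\<lambda>p. F p e)"
    and \<Omega>: "open \<Omega>" "bounded \<Omega>"
    and N: "open N" "frontier \<Omega> \<subseteq> N" "\<And>p. p \<in> N \<Longrightarrow> w p = 0"
  shows "integrable (lebesgue_on \<Omega>) (\<lambda>p. F p e)" "(LINT p|lebesgue_on \<Omega>. F p e) = 0"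
proof -
  \<comment> \<open>Points outside \<open>\<Omega>\<close> lie on the frontier, hence in
    \<open>N\<close>, or off the closure; so \<open>\<Omega>\<close> and \<open>V\<close> are an
    open cover of the plane.\<close>
  define V where "V = N \<union> - closure \<Omega>"
  define w0 where "w0 p = (if p \<in> \<Omega> then w p else 0)" for p
  define F0 where "F0 p = (if p \<in> \<Omega> then F p else (\<lambda>h. 0))" for p
  have V: "open V" "\<Omega> \<union> V = UNIV"
    using N(1,2) \<Omega>(1) by (auto simp: V_def frontier_def interior_open)
  have w0V: "w0 p = 0" if "p \<in> V" for p
    using that N(3)[of p] closure_subset[of \<Omega>] by (auto simp: w0_def V_def)
  have FN: "F p = (\<lambda>h. 0)" if "p \<in> N" for p
  proof -
    have "(w has_derivative (\<lambda>h. 0)) (at p)"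
      by (rule has_derivative_transform_within_open[where f = "\<lambda>_. 0" and s = N])
         (use that N in auto)
    then show ?thesis by (rule has_derivative_unique[OF der])
  qed
  have F0V: "F0 p = (\<lambda>h. 0)" if "p \<in> V" for p
    using that FN[of p] closure_subset[of \<Omega>] by (auto simp: F0_def V_def)
  have der0: "(w0 has_derivative F0 p) (at p)" for p
  proof (cases "p \<in> \<Omega>")
    case True
    show ?thesis
      by (rule has_derivative_transform_within_open[where f = w and s = \<Omega>])
         (use True \<Omega> der in \<open>auto simp: w0_def F0_def\<close>)
  next
    case False
    then have "p \<in> V" using V by auto
    have "(w0 has_derivative (\<lambda>h. 0)) (at p)"
      by (rule has_derivative_transform_within_open[where f = "\<lambda>_. 0" and s = V])
         (simp_all add: V(1) \<open>p \<in> V\<close> w0V)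
    then show ?thesis using F0V[OF \<open>p \<in> V\<close>] by simp
  qed
  have "continuous_on \<Omega> (\<lambda>p. F0 p e)"
    using continuous_on_subset[OF cont, of \<Omega>] by (rule continuous_on_eq) (auto simp: F0_def)
  moreover have "continuous_on V (\<lambda>p. F0 p e)"
    using continuous_on_const[of V 0] by (rule continuous_on_eq) (auto simp: F0V)
  ultimately have cont0: "continuous_on UNIV (\<lambda>p. F0 p e)"
    using continuous_on_open_Un[OF \<Omega>(1) V(1)] V(2) by metis
  obtain R where R: "\<And>p. p \<in> \<Omega> \<Longrightarrow> norm p \<le> R" using \<Omega>(2) by (auto simp: bounded_iff)
  have supp: "w0 p = 0" if "norm p > R" for p
    using that R[of p] by (auto simp: w0_def)
  note I = integral_directional_deriv_compact_support[where R = R, OF der0 e cont0 supp, simplified]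
  have m: "(\<lambda>p. F0 p e) \<in> borel_measurable lborel"
    using borel_measurable_continuous_onI[OF cont0] by simp
  have L: "\<Omega> \<in> sets lebesgue" using \<Omega>(1) by auto
  have eq: "indicator \<Omega> p * F p e = F0 p e" for p by (auto simp: F0_def)
  show "integrable (lebesgue_on \<Omega>) (\<lambda>p. F p e)"
    using I(1) L by (simp add: integrable_restrict_space eq integrable_completion[OF m])
  show "(LINT p|lebesgue_on \<Omega>. F p e) = 0"
    using I(2) L by (simp add: integral_restrict_space eq integral_completion[OF m])
qed

lemma integrable_continuous_lebesgue_on:
  fixes g :: "'a::euclidean_space \<Rightarrow> real"
  assumes "continuous_on UNIV g" "\<Omega> \<in> sets lebesgue" "bounded \<Omega>"
  shows "integrable (lebesgue_on \<Omega>) g"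
proof -
  interpret finite_measure "lebesgue_on \<Omega>"
    using assms by (intro finite_measure_lebesgue_on bounded_set_imp_lmeasurable)
  have "compact (g ` closure \<Omega>)"
    using assms by (intro compact_continuous_image) (auto intro: continuous_on_subset)
  then obtain B where "\<And>x. x \<in> closure \<Omega> \<Longrightarrow> norm (g x) \<le> B"
    by (meson bounded_iff compact_imp_bounded imageI)
  then have "AE x in lebesgue_on \<Omega>. norm (g x) \<le> B"
    using closure_subset[of \<Omega>] by (intro AE_I2) (auto simp: space_restrict_space)
  then show ?thesis
    using assms by (intro integrable_const_bound[of _ B])
       (auto intro: continuous_imp_measurable_on_sets_lebesgue continuous_on_subset)
qed

text \<open>A zero with nonzero derivative is isolated, so the set is locally a singleton, and
  negligibility is a local property.\<close>

lemma isolated_zeros_negligible: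
  fixes g g' :: "real \<Rightarrow> real"
  assumes der: "\<And>s. (g has_real_derivative g' s) (at s)"
  shows "negligible {s. g s = 0 \<and> g' s \<noteq> 0}" (is "negligible ?Z")
proof (subst locally_negligible_alt, rule ballI)
  fix s assume s: "s \<in> ?Z"
  have "((\<lambda>y. (g y - g s) / (y - s)) \<longlongrightarrow> g' s) (at s)"
    using der[of s] by (simp add: has_field_derivative_iff)
  then have "\<forall>\<^sub>F y in at s. (g y - g s) / (y - s) \<noteq> 0"
    by (rule tendsto_imp_eventually_ne) (use s in auto)
  then obtain S where S: "open S" "s \<in> S" "\<And>y. y \<in> S \<Longrightarrow> y \<noteq> s \<Longrightarrow> g y \<noteq> g s"
    unfolding eventually_at_topological by auto
  then have "?Z \<inter> S = {s}" using s by auto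
  then have "openin (top_of_set ?Z) {s}" using S(1) openin_open by metis
  then show "\<exists>U. openin (top_of_set ?Z) U \<and> s \<in> U \<and> negligible U"
    by (intro exI[of _ "{s}"]) auto
qed

text \<open>For each partial derivative, \<open>isolated_zeros_negligible\<close> on every line in
  its direction, then Fubini. Continuity provides the measurability that Fubini requires.\<close>

lemma AE_partials_zero_on_zero_set:
  fixes v :: "plane \<Rightarrow> real"
  assumes v: "\<And>p. v differentiable at p" "continuous_on UNIV (part_t v)" "continuous_on UNIV (part_x v)"
  shows "AE p in lborel. v p = 0 \<longrightarrow> part_t v p = 0 \<and> part_x v p = 0"
proof -
  have cv: "continuous_on UNIV v"
    using v(1) by (simp add: continuous_on_eq_continuous_at differentiable_imp_continuous_within)
  have m: "v \<in> borel_measurable borel" "part_t v \<in> borel_measurable borel"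
    "part_x v \<in> borel_measurable borel"
    using cv v by (auto intro: borel_measurable_continuous_onI)
  have m': "v \<in> borel_measurable (borel \<Otimes>\<^sub>M borel)" "part_t v \<in> borel_measurable (borel \<Otimes>\<^sub>M borel)"
    "part_x v \<in> borel_measurable (borel \<Otimes>\<^sub>M borel)"
    using m by (auto simp: borel_prod)
  note [measurable] = m'
  have st: "AE t in lborel. v (t, x) = 0 \<longrightarrow> part_t v (t, x) = 0" for x
  proof -
    have "negligible {t. v (t, x) = 0 \<and> part_t v (t, x) \<noteq> 0}"
      by (rule isolated_zeros_negligible) (use has_derivative_parts(2)[OF v(1), of "(_, x)"] in auto)
    moreover have "{t. v (t, x) = 0 \<and> part_t v (t, x) \<noteq> 0} \<in> sets borel"
      by measurable
    ultimately have "{t. v (t, x) = 0 \<and> part_t v (t, x) \<noteq> 0} \<in> null_sets lborel"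
      by (auto simp: negligible_iff_null_sets null_sets_def)
    from AE_not_in[OF this] show ?thesis by auto
  qed
  have sx: "AE x in lborel. v (t, x) = 0 \<longrightarrow> part_x v (t, x) = 0" for t
  proof -
    have "negligible {x. v (t, x) = 0 \<and> part_x v (t, x) \<noteq> 0}"
      by (rule isolated_zeros_negligible) (use has_derivative_parts(3)[OF v(1), of "(t, _)"] in auto)
    moreover have "{x. v (t, x) = 0 \<and> part_x v (t, x) \<noteq> 0} \<in> sets borel"
      by measurable
    ultimately have "{x. v (t, x) = 0 \<and> part_x v (t, x) \<noteq> 0} \<in> null_sets lborel"
      by (auto simp: negligible_iff_null_sets null_sets_def)
    from AE_not_in[OF this] show ?thesis by auto
  qed
  have AEx: "AE p in lborel \<Otimes>\<^sub>M lborel. v p = 0 \<longrightarrow> part_x v p = 0"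
  proof (rule lborel_pair.AE_pair_measure)
    show "{p \<in> space (lborel \<Otimes>\<^sub>M lborel). v p = 0 \<longrightarrow> part_x v p = 0} \<in> sets (lborel \<Otimes>\<^sub>M lborel)"
      by measurable
  qed (use sx in auto)
  \<comment> \<open>The exceptional sets are null in t for fixed x, while
    \<open>AE_pair_measure\<close> wants the first coordinate outermost; hence the exchange.\<close>
  have "AE x in lborel. AE t in lborel. v (t, x) = 0 \<longrightarrow> part_t v (t, x) = 0"
    using st by auto
  then have "AE t in lborel. AE x in lborel. v (t, x) = 0 \<longrightarrow> part_t v (t, x) = 0"
    by (subst (asm) lborel_pair.AE_commute) measurable
  moreover have "{p \<in> space (lborel \<Otimes>\<^sub>M lborel). v p = 0 \<longrightarrow> part_t v p = 0} \<in> sets (lborel \<Otimes>\<^sub>M lborel)"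
    by measurable
  ultimately have "AE p in lborel \<Otimes>\<^sub>M lborel. v p = 0 \<longrightarrow> part_t v p = 0"
    by (intro lborel_pair.AE_pair_measure)
  with AEx show ?thesis unfolding lborel_prod by eventually_elim simp
qed

subsection \<open>The Jacobian of two functions whose product vanishes on the frontier\<close>

text \<open>Squaring removes the kink at 0, where the difference quotient is at most
  \<open>\<bar>h\<bar>\<close> in absolute value.\<close>

lemma DERIV_max_zero_squared:
  "((\<lambda>y::real. (max 0 y)\<^sup>2) has_real_derivative 2 * max 0 y) (at y)"
proof -
  consider "y > 0" | "y < 0" | "y = 0" by linarith
  then show ?thesis
  proof cases
    case 1
    have "((\<lambda>y::real. y\<^sup>2) has_real_derivative 2 * max 0 y) (at y)"
      using 1 by (auto intro!: derivative_eq_intros)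
    then show ?thesis
      by (rule has_field_derivative_transform_within_open[where S = "{0<..}"]) (use 1 in auto)
  next
    case 2
    have "((\<lambda>y::real. 0) has_real_derivative 2 * max 0 y) (at y)"
      using 2 by (auto intro!: derivative_eq_intros)
    then show ?thesis
      by (rule has_field_derivative_transform_within_open[where S = "{..<0}"]) (use 2 in auto)
  next
    case 3
    have "((\<lambda>h::real. (max 0 h)\<^sup>2 / h) \<longlongrightarrow> 0) (at 0)"
    proof (rule Lim_null_comparison[where g = "\<lambda>h. \<bar>h\<bar>"])
      show "\<forall>\<^sub>F h::real in at 0. norm ((max 0 h)\<^sup>2 / h) \<le> \<bar>h\<bar>"
        by (rule always_eventually) (auto simp: max_def power2_eq_square)
      show "((\<lambda>h::real. \<bar>h\<bar>) \<longlongrightarrow> 0) (at 0)"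
        by (rule tendsto_rabs_zero) (rule tendsto_ident_at)
    qed
    then show ?thesis using 3 by (simp add: DERIV_def)
  qed
qed

text \<open>An even, continuously differentiable function that vanishes on the interval from -1 to 1
  and tends to 1 at both infinities. It is \<open>y / (1 + y)\<close> for the once differentiable
  truncation \<open>y = (max 0 (s\<^sup>2 - 1))\<^sup>2\<close>, so its bounds and limits are
  elementary.\<close>

definition cutoff :: "real \<Rightarrow> real" where
  "cutoff s = (max 0 (s\<^sup>2 - 1))\<^sup>2 / (1 + (max 0 (s\<^sup>2 - 1))\<^sup>2)"

definition cutoff_deriv :: "real \<Rightarrow> real" where
  "cutoff_deriv s = 4 * s * max 0 (s\<^sup>2 - 1) / (1 + (max 0 (s\<^sup>2 - 1))\<^sup>2)\<^sup>2"

lemma DERIV_cutoff: "(cutoff has_real_derivative cutoff_deriv s) (at s)"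
proof -
  have *: "((\<lambda>s::real. (max 0 (s\<^sup>2 - 1))\<^sup>2) has_real_derivative 2 * max 0 (s\<^sup>2 - 1) * (2 * s)) (at s)"
    by (rule DERIV_chain2[OF DERIV_max_zero_squared]) (auto intro!: derivative_eq_intros)
  have nz: "1 + (max 0 (s\<^sup>2 - 1))\<^sup>2 \<noteq> (0::real)" by (smt (verit) zero_le_power2)
  have "((\<lambda>s. (max 0 (s\<^sup>2 - 1))\<^sup>2 / (1 + (max 0 (s\<^sup>2 - 1))\<^sup>2)) has_real_derivative
     (2 * max 0 (s\<^sup>2 - 1) * (2 * s) * (1 + (max 0 (s\<^sup>2 - 1))\<^sup>2)
      - (max 0 (s\<^sup>2 - 1))\<^sup>2 * (0 + 2 * max 0 (s\<^sup>2 - 1) * (2 * s)))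
      / ((1 + (max 0 (s\<^sup>2 - 1))\<^sup>2) * (1 + (max 0 (s\<^sup>2 - 1))\<^sup>2))) (at s)"
    by (rule DERIV_divide[OF * DERIV_add[OF DERIV_const *] nz])
  moreover have "(2 * max 0 (s\<^sup>2 - 1) * (2 * s) * (1 + (max 0 (s\<^sup>2 - 1))\<^sup>2)
      - (max 0 (s\<^sup>2 - 1))\<^sup>2 * (0 + 2 * max 0 (s\<^sup>2 - 1) * (2 * s)))
      / ((1 + (max 0 (s\<^sup>2 - 1))\<^sup>2) * (1 + (max 0 (s\<^sup>2 - 1))\<^sup>2)) = cutoff_deriv s"
    by (simp add: cutoff_deriv_def power2_eq_square[of "1 + _"] algebra_simps)
  moreover have "(\<lambda>s. (max 0 (s\<^sup>2 - 1))\<^sup>2 / (1 + (max 0 (s\<^sup>2 - 1))\<^sup>2)) = cutoff"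
    by (simp add: cutoff_def fun_eq_iff)
  ultimately show ?thesis by simp
qed

lemma continuous_cutoff: "continuous_on A cutoff"
  using DERIV_cutoff by (meson DERIV_isCont continuous_at_imp_continuous_on)

lemma continuous_cutoff_deriv: "continuous_on A cutoff_deriv"
proof -
  have "1 + (max 0 (s\<^sup>2 - 1))\<^sup>2 \<noteq> (0::real)" for s :: real by (smt (verit) zero_le_power2)
  then show ?thesis unfolding cutoff_deriv_def by (intro continuous_intros) auto
qed

lemma cutoff_eq_0: "\<bar>s\<bar> \<le> 1 \<Longrightarrow> cutoff s = 0"
  by (simp add: cutoff_def abs_square_le_1 max_absorb1)

lemma abs_cutoff_le: "\<bar>cutoff s\<bar> \<le> 1"
proof -
  have "0 < 1 + (max 0 (s\<^sup>2 - 1))\<^sup>2" by (smt (verit) zero_le_power2)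
  then show ?thesis by (simp add: cutoff_def)
qed

text \<open>The product with \<open>s\<close> is what differentiating
  \<open>M * cutoff (c * M)\<close> produces. A bound on it over all \<open>s\<close> is therefore
  uniform in the level \<open>c\<close>, as dominated convergence demands.\<close>

lemma abs_cutoff_deriv_le: "\<bar>s * cutoff_deriv s\<bar> \<le> 8"
proof -
  define m where "m = max 0 (s\<^sup>2 - 1)"
  \<comment> \<open>Either \<open>m\<close> is 0 or \<open>s\<^sup>2 = m + 1\<close>; the second
    identity covers both cases.\<close>
  have m: "m \<ge> 0" "s\<^sup>2 * m = (m + 1) * m" by (auto simp: m_def max_def)
  have "m \<le> 1 + m\<^sup>2"
    using zero_le_power2[of "m - 1"] m(1) by (simp add: power2_diff)
  then have "4 * ((m + 1) * m) \<le> 8 * (1 + m\<^sup>2)"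
    by (simp add: algebra_simps power2_eq_square)
  also have "\<dots> \<le> 8 * (1 + m\<^sup>2)\<^sup>2"
    by (simp add: power2_eq_square[of "1 + _"] algebra_simps)
  finally have "4 * ((m + 1) * m) / (1 + m\<^sup>2)\<^sup>2 \<le> 8"
    by (simp add: divide_le_eq add_nonneg_eq_0_iff)
  moreover have "s * cutoff_deriv s = 4 * ((m + 1) * m) / (1 + m\<^sup>2)\<^sup>2"
    unfolding cutoff_deriv_def m_def[symmetric] using m(2) by (simp add: power2_eq_square)
  ultimately show ?thesis using m(1) by simp
qed

lemma cutoff_tendsto:
  assumes "s \<noteq> 0"
  shows "(\<lambda>n. cutoff (real n * s)) \<longlonglongrightarrow> 1"
    and "(\<lambda>n. cutoff (real n * s) + real n * s * cutoff_deriv (real n * s)) \<longlonglongrightarrow> 1"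
proof -
  have top: "filterlim (\<lambda>n. real n * \<bar>s\<bar>) at_top sequentially"
    using assms by real_asymp
  have 1: "(cutoff \<longlongrightarrow> 1) at_top" "((\<lambda>s. cutoff s + s * cutoff_deriv s) \<longlongrightarrow> 1) at_top"
    unfolding cutoff_def cutoff_deriv_def by real_asymp+
  \<comment> \<open>Both expressions are even in their argument, so the limits at plus infinity also
    serve negative \<open>s\<close>.\<close>
  have abs: "cutoff \<bar>y\<bar> = cutoff y" "\<bar>y\<bar> * cutoff_deriv \<bar>y\<bar> = y * cutoff_deriv y" for y
    by (auto simp: cutoff_def cutoff_deriv_def)
  have abs': "real n * \<bar>s\<bar> = \<bar>real n * s\<bar>" for n by (simp add: abs_mult)
  show "(\<lambda>n. cutoff (real n * s)) \<longlonglongrightarrow> 1"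
    using filterlim_compose[OF 1(1) top] by (simp only: abs' abs)
  show "(\<lambda>n. cutoff (real n * s) + real n * s * cutoff_deriv (real n * s)) \<longlonglongrightarrow> 1"
    using filterlim_compose[OF 1(2) top] by (simp only: abs' abs)
qed

text \<open>The integrand is the divergence of a field \<open>A E \<nabla>\<Phi>\<close>, rotated by a right angle, where
  \<open>A = M \<cdot> cutoff (c M)\<close> and \<open>E = cutoff (c \<Phi>)\<close>. Since \<open>A E\<close> vanishes in a neighbourhood of the
  frontier, the field extends by zero to the plane, and no regularity of the boundary is needed.\<close>

lemma integral_truncated_jacobian:
  assumes sm: "smooth M" "smooth \<Phi>" and \<Omega>: "open \<Omega>" "bounded \<Omega>"
    and bd: "\<And>p. p \<in> frontier \<Omega> \<Longrightarrow> M p = 0 \<or> \<Phi> p = 0"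
    and c: "c \<ge> 0"
  shows "(LINT p|lebesgue_on \<Omega>.
     (cutoff (c * M p) + c * M p * cutoff_deriv (c * M p)) * cutoff (c * \<Phi> p) *
       (part_x M p * part_t \<Phi> p - part_t M p * part_x \<Phi> p)) = 0"
proof -
  define A where "A p = M p * cutoff (c * M p)" for p
  define E where "E p = cutoff (c * \<Phi> p)" for p
  define k where "k p = cutoff (c * M p) + c * M p * cutoff_deriv (c * M p)" for p
  define l where "l p = c * cutoff_deriv (c * \<Phi> p)" for p
  note D = has_derivative_parts(1)
  note M = smoothD[OF sm(1)] and P = smoothD[OF sm(2)]
  have dcut: "((\<lambda>p. cutoff (c * v p)) has_derivative
      (\<lambda>h. c * cutoff_deriv (c * v p) * (fst h * part_t v p + snd h * part_x v p))) (at p)"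
    if "v differentiable at p" for v p
  proof -
    have "((\<lambda>p. c * v p) has_derivative (\<lambda>h. c * (fst h * part_t v p + snd h * part_x v p))) (at p)"
      using D[OF that] by (rule has_derivative_mult_right)
    from has_derivative_compose[OF this DERIV_cutoff[unfolded has_field_derivative_def]]
    show ?thesis by (simp add: mult_ac)
  qed
  have dA: "(A has_derivative (\<lambda>h. k p * (fst h * part_t M p + snd h * part_x M p))) (at p)" for p
    unfolding A_def k_def
    by (rule has_derivative_eq_rhs[OF has_derivative_mult[OF D[OF M(1)] dcut[OF M(1)]]])
       (simp add: fun_eq_iff algebra_simps)
  have dE: "(E has_derivative (\<lambda>h. l p * (fst h * part_t \<Phi> p + snd h * part_x \<Phi> p))) (at p)" for p
    unfolding E_def l_def using dcut[OF P(1)] by simp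
  \<comment> \<open>The product rule for \<open>A * E * \<phi>\<close>, kept generic in
    \<open>\<phi>\<close> because it is needed for both components of the field.\<close>
  define F where "F \<phi> p h = (A p * E p) * (fst h * part_t \<phi> p + snd h * part_x \<phi> p)
       + (A p * (l p * (fst h * part_t \<Phi> p + snd h * part_x \<Phi> p))
          + k p * (fst h * part_t M p + snd h * part_x M p) * E p) * \<phi> p" for \<phi> p and h :: plane
  have dF: "((\<lambda>p. A p * E p * \<phi> p) has_derivative F \<phi> p) (at p)"
    if "\<phi> differentiable at p" for \<phi> p
    unfolding F_def
    using has_derivative_mult[OF has_derivative_mult[OF dA dE] D[OF that]] by simp
  have cAE: "continuous_on UNIV A" "continuous_on UNIV E" "continuous_on UNIV k" "continuous_on UNIV l"
    unfolding A_def E_def k_def l_def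
    by (intro continuous_intros M P continuous_on_compose2[OF continuous_cutoff[of UNIV]]
        continuous_on_compose2[OF continuous_cutoff_deriv[of UNIV]] subset_UNIV)+
  have cF: "continuous_on UNIV (\<lambda>p. F (part_x \<Phi>) p (1, 0))" "continuous_on UNIV (\<lambda>p. F (part_t \<Phi>) p (0, 1))"
    unfolding F_def using P(7,8) by (auto intro!: continuous_intros cAE M(4-6) P(4-7))
  \<comment> \<open>On the first set \<open>A\<close> is 0, on the second \<open>E\<close> is 0,
    since \<open>cutoff\<close> vanishes on arguments of modulus at most 1. Strict inequalities make
    \<open>N\<close> open, and a frontier point has one of the two values equal to 0.\<close>
  define N where "N = {p. \<bar>c * M p\<bar> < 1} \<union> {p. \<bar>c * \<Phi> p\<bar> < 1}"
  have "open N"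
    unfolding N_def by (intro open_Un open_Collect_less continuous_intros M P)
  moreover have "p \<in> N" if "p \<in> frontier \<Omega>" for p
    using bd[OF that] by (auto simp: N_def)
  ultimately have N: "open N" "frontier \<Omega> \<subseteq> N" by auto
  have zero: "A p * E p * \<phi> p = 0" if "p \<in> N" for p \<phi>
    using that by (auto simp: N_def A_def E_def cutoff_eq_0)
  note I1 = integral_directional_deriv_zero_near_frontier[where w = "\<lambda>p. A p * E p * part_x \<Phi> p" and F = "F (part_x \<Phi>)" and e = "(1, 0)",
      OF dF[OF P(3)] _ cF(1) \<Omega> N zero[where \<phi> = "part_x \<Phi>"]]
  note I2 = integral_directional_deriv_zero_near_frontier[where w = "\<lambda>p. A p * E p * part_t \<Phi> p" and F = "F (part_t \<Phi>)" and e = "(0, 1)",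
      OF dF[OF P(2)] _ cF(2) \<Omega> N zero[where \<phi> = "part_t \<Phi>"]]
  have "(LINT p|lebesgue_on \<Omega>. F (part_t \<Phi>) p (0, 1) - F (part_x \<Phi>) p (1, 0)) = 0"
    using I1 I2 by (subst Bochner_Integration.integral_diff) auto
  \<comment> \<open>The mixed second derivatives cancel by symmetry. The terms with \<open>l\<close>
    cancel because \<open>E\<close> depends on \<open>\<Phi>\<close> alone, so its gradient is
    parallel to that of \<open>\<Phi>\<close>; this removes the factor \<open>c\<close> that no
    uniform bound could absorb.\<close>
  moreover have "F (part_t \<Phi>) p (0, 1) - F (part_x \<Phi>) p (1, 0)
      = k p * E p * (part_x M p * part_t \<Phi> p - part_t M p * part_x \<Phi> p)" for p
    unfolding F_def using P(8) by (simp add: algebra_simps)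
  ultimately show ?thesis by (simp add: k_def E_def)
qed

text \<open>Dominated convergence in \<open>integral_truncated_jacobian\<close> along
  \<open>c = real n\<close>: where neither function is 0 both factors tend to 1, and elsewhere the
  Jacobian is 0 almost everywhere.\<close>

lemma integral_jacobian_eq_0:
  assumes sm: "smooth M" "smooth \<Phi>" and \<Omega>: "open \<Omega>" "bounded \<Omega>"
    and bd: "\<And>p. p \<in> frontier \<Omega> \<Longrightarrow> M p = 0 \<or> \<Phi> p = 0"
  shows "(LINT p|lebesgue_on \<Omega>. part_x M p * part_t \<Phi> p - part_t M p * part_x \<Phi> p) = 0"
proof -
  define J where "J p = part_x M p * part_t \<Phi> p - part_t M p * part_x \<Phi> p" for p
  define k where "k n p = cutoff (real n * M p) + real n * M p * cutoff_deriv (real n * M p)" for n p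
  define Jn where "Jn n p = k n p * cutoff (real n * \<Phi> p) * J p" for n p
  note M = smoothD[OF sm(1)] and P = smoothD[OF sm(2)]
  have L: "\<Omega> \<in> sets lebesgue" using \<Omega>(1) by auto
  have cJ: "continuous_on UNIV J"
    unfolding J_def by (intro continuous_intros M P)
  have cJn: "continuous_on UNIV (Jn n)" for n
    unfolding Jn_def k_def
    by (intro continuous_intros cJ M P continuous_on_compose2[OF continuous_cutoff[of UNIV]]
        continuous_on_compose2[OF continuous_cutoff_deriv[of UNIV]] subset_UNIV)
  have int: "integrable (lebesgue_on \<Omega>) J" "\<And>n. integrable (lebesgue_on \<Omega>) (Jn n)"
    using integrable_continuous_lebesgue_on[OF _ L \<Omega>(2)] cJ cJn by auto
  have "AE p in lborel. (M p = 0 \<or> \<Phi> p = 0) \<longrightarrow> J p = 0"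
    using AE_partials_zero_on_zero_set[OF M(1,5,6)] AE_partials_zero_on_zero_set[OF P(1,5,6)]
    by eventually_elim (auto simp: J_def)
  then have "AE p in lebesgue. (M p = 0 \<or> \<Phi> p = 0) \<longrightarrow> J p = 0"
    by (rule AE_completion)
  then have "AE p in lebesgue. p \<in> \<Omega> \<longrightarrow> (M p = 0 \<or> \<Phi> p = 0) \<longrightarrow> J p = 0"
    by eventually_elim auto
  then have ae: "AE p in lebesgue_on \<Omega>. (M p = 0 \<or> \<Phi> p = 0) \<longrightarrow> J p = 0"
    using L by (subst AE_restrict_space_iff) auto
  have "(\<lambda>n. integral\<^sup>L (lebesgue_on \<Omega>) (Jn n)) \<longlonglongrightarrow> integral\<^sup>L (lebesgue_on \<Omega>) J"
  \<comment> \<open>The constant is 1 + 8, from \<open>abs_cutoff_le\<close> and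
    \<open>abs_cutoff_deriv_le\<close>; the cutoff of \<open>\<Phi>\<close> contributes a factor of
    at most 1.\<close>
  proof (rule integral_dominated_convergence[where w = "\<lambda>p. 9 * \<bar>J p\<bar>"])
    show "AE p in lebesgue_on \<Omega>. (\<lambda>n. Jn n p) \<longlonglongrightarrow> J p"
      using ae
    proof eventually_elim
      case (elim p)
      show ?case
      proof (cases "M p = 0 \<or> \<Phi> p = 0")
        case True
        then show ?thesis using elim by (simp add: Jn_def)
      next
        case False
        then have "(\<lambda>n. k n p * cutoff (real n * \<Phi> p) * J p) \<longlonglongrightarrow> 1 * 1 * J p"
          unfolding k_def by (intro tendsto_intros cutoff_tendsto) auto
        then show ?thesis by (simp add: Jn_def)
      qed
    qed
    show "AE p in lebesgue_on \<Omega>. norm (Jn n p) \<le> 9 * \<bar>J p\<bar>" for n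
    proof (rule AE_I2)
      fix p
      have "\<bar>k n p\<bar> \<le> 9"
        unfolding k_def using abs_cutoff_le[of "real n * M p"] abs_cutoff_deriv_le[of "real n * M p"]
        by linarith
      then have "\<bar>k n p * cutoff (real n * \<Phi> p)\<bar> \<le> 9 * 1"
        unfolding abs_mult by (intro mult_mono abs_cutoff_le) auto
      then show "norm (Jn n p) \<le> 9 * \<bar>J p\<bar>"
        unfolding Jn_def real_norm_def abs_mult[of _ "J p"] by (intro mult_right_mono) auto
    qed
    show "integrable (lebesgue_on \<Omega>) (\<lambda>p. 9 * \<bar>J p\<bar>)"
      using int(1) by simp
  qed (use int in auto)
  moreover have "integral\<^sup>L (lebesgue_on \<Omega>) (Jn n) = 0" for n
    using integral_truncated_jacobian[OF sm \<Omega> bd, of "real n"]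
    by (simp add: Jn_def[abs_def] k_def J_def)
  ultimately show ?thesis
    by (simp add: LIMSEQ_const_iff J_def[abs_def])
qed

subsection \<open>Square-integrable functions\<close>

lemma L2_iff_integrable: "v \<in> L2 M \<longleftrightarrow> v \<in> borel_measurable M \<and> integrable M (\<lambda>x. (norm (v x))\<^sup>2)"
  by (simp add: L2_def)

lemma L2_norm_nonneg: "L2_norm M v \<ge> 0"
  by (simp add: L2_norm_def)

lemma L2_norm_squared: "(L2_norm M v)\<^sup>2 = (LINT x|M. (norm (v x))\<^sup>2)"
  by (simp add: L2_norm_def)

lemma L2_bound:
  assumes "w \<in> L2 M" "v \<in> borel_measurable M" "c \<ge> 0" "AE x in M. norm (v x) \<le> c * norm (w x)"
  shows "v \<in> L2 M" "L2_norm M v \<le> c * L2_norm M w"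
proof -
  have le: "AE x in M. (norm (v x))\<^sup>2 \<le> c\<^sup>2 * (norm (w x))\<^sup>2"
    using assms(4) by eventually_elim (simp flip: power_mult_distrib add: power_mono)
  have w: "integrable M (\<lambda>x. (norm (w x))\<^sup>2)" using assms(1) by (simp add: L2_iff_integrable)
  have v: "integrable M (\<lambda>x. (norm (v x))\<^sup>2)"
    by (rule Bochner_Integration.integrable_bound[where f = "\<lambda>x. c\<^sup>2 * (norm (w x))\<^sup>2"])
       (use w le assms(2) in auto)
  then show "v \<in> L2 M" using assms(2) by (simp add: L2_iff_integrable)
  have "(L2_norm M v)\<^sup>2 \<le> (LINT x|M. c\<^sup>2 * (norm (w x))\<^sup>2)"
    unfolding L2_norm_squared using v w le by (intro integral_mono_AE) auto
  also have "\<dots> = (c * L2_norm M w)\<^sup>2"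
    by (simp add: L2_norm_squared power_mult_distrib)
  finally show "L2_norm M v \<le> c * L2_norm M w"
    by (rule power2_le_imp_le) (simp add: assms(3) L2_norm_nonneg)
qed

lemma L2_add:
  assumes "v \<in> L2 M" "w \<in> L2 M"
  shows "(\<lambda>x. v x + w x) \<in> L2 M"
proof -
  have "(norm (v x + w x))\<^sup>2 \<le> 2 * (norm (v x))\<^sup>2 + 2 * (norm (w x))\<^sup>2" for x
  proof -
    have "(norm (v x + w x))\<^sup>2 \<le> (norm (v x) + norm (w x))\<^sup>2"
      by (intro power_mono norm_triangle_ineq) auto
    also have "\<dots> \<le> 2 * (norm (v x))\<^sup>2 + 2 * (norm (w x))\<^sup>2"
      using zero_le_power2[of "norm (v x) - norm (w x)"]
      by (simp add: power2_eq_square algebra_simps)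
    finally show ?thesis .
  qed
  then have "integrable M (\<lambda>x. (norm (v x + w x))\<^sup>2)"
    using assms by (intro Bochner_Integration.integrable_bound[where g = "\<lambda>x. (norm (v x + w x))\<^sup>2"
        and f = "\<lambda>x. 2 * (norm (v x))\<^sup>2 + 2 * (norm (w x))\<^sup>2"])
      (auto simp: L2_iff_integrable)
  then show ?thesis using assms by (auto simp: L2_iff_integrable)
qed

lemma L2_scale:
  assumes "v \<in> L2 M"
  shows "(\<lambda>x. c *\<^sub>R v x) \<in> L2 M"
  by (rule L2_bound(1)[where w = v and c = "\<bar>c\<bar>"]) (use assms in \<open>auto simp: L2_iff_integrable\<close>)

lemma L2_diff:
  assumes "v \<in> L2 M" "w \<in> L2 M"
  shows "(\<lambda>x. v x - w x) \<in> L2 M"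
  using L2_add[OF assms(1) L2_scale[OF assms(2), of "-1"]] by simp

text \<open>Polarization reduces the product to squared norms, which are integrable because
  \<open>L2\<close> is closed under addition.\<close>

lemma integrable_L2_inner:
  assumes "v \<in> L2 M" "w \<in> L2 M"
  shows "integrable M (\<lambda>x. v x \<bullet> w x)"
proof -
  have "v x \<bullet> w x = ((norm (v x + w x))\<^sup>2 - (norm (v x))\<^sup>2 - (norm (w x))\<^sup>2) / 2" for x
    by (rule dot_norm)
  moreover have "integrable M (\<lambda>x. ((norm (v x + w x))\<^sup>2 - (norm (v x))\<^sup>2 - (norm (w x))\<^sup>2) / 2)"
    using assms L2_add[OF assms] by (simp add: L2_iff_integrable)
  ultimately show ?thesis by presburger
qed

lemma L2_inner_commute: "L2_inner M v w = L2_inner M w v"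
  by (simp add: L2_inner_def inner_commute)

lemma L2_inner_diff_left:
  assumes "v \<in> L2 M" "v' \<in> L2 M" "w \<in> L2 M"
  shows "L2_inner M (\<lambda>x. v x - v' x) w = L2_inner M v w - L2_inner M v' w"
  using assms by (simp add: L2_inner_def inner_diff_left integrable_L2_inner)

lemma L2_norm_add_scaled_squared:
  assumes "v \<in> L2 M" "w \<in> L2 M"
  shows "(L2_norm M (\<lambda>x. a *\<^sub>R v x + b *\<^sub>R w x))\<^sup>2
    = a\<^sup>2 * (L2_norm M v)\<^sup>2 + 2 * a * b * L2_inner M v w + b\<^sup>2 * (L2_norm M w)\<^sup>2"
proof -
  have "(norm (a *\<^sub>R v x + b *\<^sub>R w x))\<^sup>2
      = a\<^sup>2 * (norm (v x))\<^sup>2 + 2 * a * b * (v x \<bullet> w x) + b\<^sup>2 * (norm (w x))\<^sup>2" for x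
    unfolding power2_norm_eq_inner
    by (simp add: inner_add_left inner_add_right inner_commute[of "w x" "v x"]
        power2_eq_square algebra_simps)
  then show ?thesis
    using assms integrable_L2_inner[OF assms]
    by (simp add: L2_norm_squared L2_inner_def L2_iff_integrable)
qed

lemma L2_Cauchy_Schwarz:
  assumes "v \<in> L2 M" "w \<in> L2 M"
  shows "\<bar>L2_inner M v w\<bar> \<le> L2_norm M v * L2_norm M w"
proof -
  define a where "a = L2_norm M v"
  define b where "b = L2_norm M w"
  have a: "a \<ge> 0" and b: "b \<ge> 0" by (simp_all add: a_def b_def L2_norm_nonneg)
  have q: "0 \<le> s\<^sup>2 * a\<^sup>2 + 2 * s * t * L2_inner M v w + t\<^sup>2 * b\<^sup>2" for s t
    using L2_norm_add_scaled_squared[OF assms, of s t] zero_le_power2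
    unfolding a_def b_def by metis
  \<comment> \<open>The quadratic form is evaluated at \<open>(B, A)\<close> and
    \<open>(B, -A)\<close> and divided by \<open>2 * (A * B)\<close>. Enlarging both norms by
    \<open>\<epsilon>\<close> keeps the divisor positive even if a norm is 0; then
    \<open>\<epsilon>\<close> tends to 0.\<close>
  have "\<bar>L2_inner M v w\<bar> \<le> (a + \<epsilon>) * (b + \<epsilon>)" if "\<epsilon> > 0" for \<epsilon>
  proof -
    define A where "A = a + \<epsilon>"
    define B where "B = b + \<epsilon>"
    have AB: "A > 0" "B > 0" "a\<^sup>2 \<le> A\<^sup>2" "b\<^sup>2 \<le> B\<^sup>2"
      using a b that by (auto simp: A_def B_def)
    then have le: "B\<^sup>2 * a\<^sup>2 \<le> B\<^sup>2 * A\<^sup>2" "A\<^sup>2 * b\<^sup>2 \<le> A\<^sup>2 * B\<^sup>2"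
      by (auto intro: mult_left_mono)
    have "0 \<le> 2 * (A * B) * (A * B + L2_inner M v w)"
      using q[of B A] le by (simp add: power2_eq_square algebra_simps)
    moreover have "0 \<le> 2 * (A * B) * (A * B - L2_inner M v w)"
      using q[of B "-A"] le by (simp add: power2_eq_square algebra_simps)
    moreover have "0 < 2 * (A * B)" using AB by simp
    ultimately have "0 \<le> A * B + L2_inner M v w" "0 \<le> A * B - L2_inner M v w"
      by (simp_all only: zero_le_mult_iff) linarith+
    then show ?thesis by (simp add: A_def B_def)
  qed
  then have "\<forall>\<^sub>F \<epsilon> in at_right 0. \<bar>L2_inner M v w\<bar> \<le> (a + \<epsilon>) * (b + \<epsilon>)"
    by (rule eventually_mono[OF eventually_at_right_less[of "0::real"]])
  moreover have "((\<lambda>\<epsilon>. (a + \<epsilon>) * (b + \<epsilon>)) \<longlongrightarrow> (a + 0) * (b + 0)) (at_right 0)"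
    by (intro tendsto_intros)
  ultimately show ?thesis
    using tendsto_lowerbound[of "\<lambda>\<epsilon>. (a + \<epsilon>) * (b + \<epsilon>)"] trivial_limit_at_right_real[of "0::real"]
    by (simp add: a_def b_def)
qed

lemma L2_norm_triangle:
  assumes "v \<in> L2 M" "w \<in> L2 M"
  shows "L2_norm M (\<lambda>x. v x + w x) \<le> L2_norm M v + L2_norm M w"
proof (rule power2_le_imp_le)
  show "(L2_norm M (\<lambda>x. v x + w x))\<^sup>2 \<le> (L2_norm M v + L2_norm M w)\<^sup>2"
    using L2_norm_add_scaled_squared[OF assms, of 1 1] L2_Cauchy_Schwarz[OF assms]
    by (simp add: power2_sum)
qed (simp add: L2_norm_nonneg)

lemma L2_norm_triangle_diff:
  assumes "v \<in> L2 M" "w \<in> L2 M"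
  shows "L2_norm M (\<lambda>x. v x - w x) \<le> L2_norm M v + L2_norm M w"
  using L2_norm_triangle[OF assms(1) L2_scale[OF assms(2), of "-1"]] by (simp add: L2_norm_def)

lemma L2_norm_cong_AE:
  assumes "v \<in> borel_measurable M" "w \<in> borel_measurable M" "AE x in M. norm (v x) = norm (w x)"
  shows "L2_norm M v = L2_norm M w"
proof -
  have "(LINT x|M. (norm (v x))\<^sup>2) = (LINT x|M. (norm (w x))\<^sup>2)"
    by (rule integral_cong_AE) (use assms in auto)
  then show ?thesis by (simp add: L2_norm_def)
qed

lemma L2_inner_tendsto:
  assumes L2: "\<And>n. v n \<in> L2 M" "v' \<in> L2 M" "w \<in> L2 M"
    and lim: "(\<lambda>n. L2_norm M (\<lambda>x. v n x - v' x)) \<longlonglongrightarrow> 0"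
  shows "(\<lambda>n. L2_inner M (v n) w) \<longlonglongrightarrow> L2_inner M v' w"
proof -
  have "(\<lambda>n. L2_inner M (v n) w - L2_inner M v' w) \<longlonglongrightarrow> 0"
  proof (rule Lim_null_comparison)
    show "\<forall>\<^sub>F n in sequentially. norm (L2_inner M (v n) w - L2_inner M v' w)
        \<le> L2_norm M (\<lambda>x. v n x - v' x) * L2_norm M w"
      using L2_Cauchy_Schwarz[OF L2_diff[OF L2(1,2)] L2(3)]
      unfolding L2_inner_diff_left[OF L2, symmetric] real_norm_def by (rule always_eventually[OF allI])
    show "(\<lambda>n. L2_norm M (\<lambda>x. v n x - v' x) * L2_norm M w) \<longlonglongrightarrow> 0"
      using tendsto_mult_left_zero[OF lim] .
  qed
  then show ?thesis by (rule LIM_zero_cancel)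
qed

lemma (in finite_measure) bounded_imp_L2:
  assumes "v \<in> borel_measurable M" "AE x in M. norm (v x) \<le> c"
  shows "v \<in> L2 M"
proof -
  have "integrable M (\<lambda>x. (norm (v x))\<^sup>2)"
    by (rule integrable_const_bound[where B = "c\<^sup>2"])
       (use assms in \<open>auto elim!: eventually_mono intro: power_mono\<close>)
  then show ?thesis using assms by (simp add: L2_iff_integrable)
qed

lemma L2_Pair:
  fixes v w :: "'a \<Rightarrow> real"
  assumes "v \<in> L2 M" "w \<in> L2 M"
  shows "(\<lambda>x. (v x, w x)) \<in> L2 M"
proof -
  have "(\<lambda>x. (v x, w x)) \<in> borel_measurable M"
    using assms by (auto simp: L2_iff_integrable borel_prod[symmetric])
  then show ?thesis
    using assms by (simp add: L2_iff_integrable norm_Pair)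
qed

subsection \<open>Orthogonality of gradients and rotated gradients\<close>

lemma wderiv_L2:
  assumes "v \<in> Hm \<Omega> m" "i + j \<le> m"
  shows "wderiv \<Omega> i j v \<in> L2 (lebesgue_on \<Omega>)"
proof -
  have "\<exists>w. is_weak_deriv \<Omega> i j v w" using assms by (auto simp: Hm_def)
  then have "is_weak_deriv \<Omega> i j v (wderiv \<Omega> i j v)" unfolding wderiv_def by (rule someI_ex)
  then show ?thesis by (simp add: is_weak_deriv_def)
qed

lemma grad_L2:
  assumes "v \<in> Hm \<Omega> 1"
  shows "grad \<Omega> v \<in> L2 (lebesgue_on \<Omega>)" "grad_perp \<Omega> v \<in> L2 (lebesgue_on \<Omega>)"
  unfolding grad_def grad_perp_def
  using wderiv_L2[OF assms, of 1 0] wderiv_L2[OF assms, of 0 1]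
    L2_scale[OF wderiv_L2[OF assms, of 1 0], of "-1"] by (auto intro!: L2_Pair)

text \<open>The rotation by a right angle is an isometry; this carries the approximation of
  \<open>\<psi>\<close>, given for gradients, over to rotated gradients.\<close>

lemma norm_grad_perp_diff:
  "norm (grad_perp \<Omega> v p - grad_perp \<Omega> w p) = norm (grad \<Omega> v p - grad \<Omega> w p)"
  by (simp add: grad_def grad_perp_def norm_Pair power2_commute add.commute)

text \<open>Only the closures of the two boundary parts cover the frontier: the points where they
  meet are reached by continuity.\<close>

lemma smooth_approx_vanishes_on_closure:
  assumes "smooth_approx \<Omega> v \<Phi>" "\<forall>n. \<forall>p\<in>S. \<Phi> n p = 0" "p \<in> closure S"
  shows "\<Phi> n p = 0"
proof (rule continuous_constant_on_closure[OF _ _ assms(3)])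
  show "continuous_on (closure S) (\<Phi> n)"
    using assms(1) smoothD(4) continuous_on_subset by (fastforce simp: smooth_approx_def)
qed (use assms in auto)

lemma smooth_gradient_L2:
  assumes "smooth v" "open \<Omega>" "bounded \<Omega>"
  shows "(\<lambda>p. (part_t v p, part_x v p)) \<in> L2 (lebesgue_on \<Omega>)"
    "(\<lambda>p. (part_x v p, - part_t v p)) \<in> L2 (lebesgue_on \<Omega>)"
proof -
  have L: "\<Omega> \<in> sets lebesgue" using assms by auto
  have *: "u \<in> L2 (lebesgue_on \<Omega>)" if u: "continuous_on UNIV u" for u :: "plane \<Rightarrow> real"
    using integrable_continuous_lebesgue_on[OF _ L assms(3), of "\<lambda>p. (norm (u p))\<^sup>2"] 
      integrable_continuous_lebesgue_on[OF u L assms(3)] u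
    by (auto simp: L2_iff_integrable intro!: continuous_intros)
  show "(\<lambda>p. (part_t v p, part_x v p)) \<in> L2 (lebesgue_on \<Omega>)"
    "(\<lambda>p. (part_x v p, - part_t v p)) \<in> L2 (lebesgue_on \<Omega>)"
    using smoothD(5,6)[OF assms(1)] by (auto intro!: L2_Pair * continuous_intros)
qed

lemma grad_perp_orthogonal_grad:
  assumes \<Omega>: "open \<Omega>" "bounded \<Omega>" and fr: "frontier \<Omega> \<subseteq> closure \<Gamma>I \<union> closure \<Gamma>C"
    and \<mu>: "\<mu> \<in> H1_zero \<Omega> \<Gamma>I" and \<phi>: "\<phi> \<in> H1_zero \<Omega> \<Gamma>C"
  shows "L2_inner (lebesgue_on \<Omega>) (grad_perp \<Omega> \<mu>) (grad \<Omega> \<phi>) = 0"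
proof -
  let ?L = "lebesgue_on \<Omega>"
  obtain m where m: "smooth_approx \<Omega> \<mu> m" "\<forall>n. \<forall>p\<in>\<Gamma>I. m n p = 0"
    using \<mu> by (auto simp: H1_zero_def zero_on_boundary_part_def)
  obtain \<Phi> where \<Phi>: "smooth_approx \<Omega> \<phi> \<Phi>" "\<forall>n. \<forall>p\<in>\<Gamma>C. \<Phi> n p = 0"
    using \<phi> by (auto simp: H1_zero_def zero_on_boundary_part_def)
  define gm where "gm n p = (part_x (m n) p, - part_t (m n) p)" for n p
  define g\<Phi> where "g\<Phi> n p = (part_t (\<Phi> n) p, part_x (\<Phi> n) p)" for n p
  have sm: "smooth (m n)" "smooth (\<Phi> n)" for n
    using m(1) \<Phi>(1) by (auto simp: smooth_approx_def)
  have gm: "gm n \<in> L2 ?L" and g\<Phi>: "g\<Phi> n \<in> L2 ?L" for n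
    unfolding gm_def g\<Phi>_def using smooth_gradient_L2 sm \<Omega> by auto
  have H: "\<mu> \<in> Hm \<Omega> 1" "\<phi> \<in> Hm \<Omega> 1" using \<mu> \<phi> by (auto simp: H1_zero_def)
  note g\<mu> = grad_L2(2)[OF H(1)] and g\<phi> = grad_L2(1)[OF H(2)]
  have zero: "L2_inner ?L (gm k) (g\<Phi> n) = 0" for k n
  proof -
    have "m k p = 0 \<or> \<Phi> n p = 0" if "p \<in> frontier \<Omega>" for p
      using that fr smooth_approx_vanishes_on_closure[OF m] smooth_approx_vanishes_on_closure[OF \<Phi>]
      by blast
    from integral_jacobian_eq_0[OF sm \<Omega> this] show ?thesis
      by (simp add: L2_inner_def gm_def g\<Phi>_def)
  qed
  have "norm (gm n p - grad_perp \<Omega> \<mu> p)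
      = norm ((part_t (m n) p, part_x (m n) p) - grad \<Omega> \<mu> p)" for n p
    by (simp add: gm_def grad_perp_def grad_def norm_Pair power2_commute add.commute)
  then have "L2_norm ?L (\<lambda>p. gm n p - grad_perp \<Omega> \<mu> p)
      = L2_norm ?L (\<lambda>p. (part_t (m n) p, part_x (m n) p) - grad \<Omega> \<mu> p)" for n
    by (simp add: L2_norm_def)
  then have "(\<lambda>n. L2_norm ?L (\<lambda>p. gm n p - grad_perp \<Omega> \<mu> p)) \<longlonglongrightarrow> 0"
    using m(1) by (simp add: smooth_approx_def)
  \<comment> \<open>The products vanish for all pairs of indices, so the limits can be taken one
    after the other, each in one argument of the inner product with the other fixed.\<close>
  from L2_inner_tendsto[OF gm g\<mu> g\<Phi> this]
  have zero': "L2_inner ?L (grad_perp \<Omega> \<mu>) (g\<Phi> n) = 0" for n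
    by (simp add: zero LIMSEQ_const_iff)
  have "(\<lambda>n. L2_norm ?L (\<lambda>p. g\<Phi> n p - grad \<Omega> \<phi> p)) \<longlonglongrightarrow> 0"
    using \<Phi>(1) by (simp add: smooth_approx_def g\<Phi>_def)
  from L2_inner_tendsto[OF g\<Phi> g\<phi> g\<mu> this] show ?thesis
    by (simp add: zero' L2_inner_commute[of _ _ "grad_perp \<Omega> \<mu>"] LIMSEQ_const_iff)
qed

subsection \<open>Locally Lipschitz fluxes\<close>

lemma flux_lipschitz:
  assumes "locally_lipschitz_flux f"
  obtains K where "K > 0" "\<And>a b. \<bar>a\<bar> \<le> R \<Longrightarrow> \<bar>b\<bar> \<le> R \<Longrightarrow> norm (f a - f b) \<le> K * \<bar>a - b\<bar>"
proof -
  obtain K where K: "K > 0" "\<forall>a\<in>{-R..R}. \<forall>b\<in>{-R..R}.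
      \<bar>fst (f a) - fst (f b)\<bar> \<le> K * \<bar>a - b\<bar> \<and> \<bar>snd (f a) - snd (f b)\<bar> \<le> K * \<bar>a - b\<bar>"
    using assms unfolding locally_lipschitz_flux_def by (meson compact_Icc)
  show thesis
  proof
    show "norm (f a - f b) \<le> 2 * K * \<bar>a - b\<bar>" if "\<bar>a\<bar> \<le> R" "\<bar>b\<bar> \<le> R" for a b
    proof -
      have "norm (f a - f b) \<le> norm (fst (f a - f b)) + norm (snd (f a - f b))"
        by (metis norm_Pair_le prod.collapse)
      also have "\<dots> \<le> 2 * K * \<bar>a - b\<bar>"
        using K(2)[rule_format, of a b] that by (auto simp: abs_le_iff)
      finally show ?thesis .
    qed
  qed (use K in auto)
qed

lemma continuous_flux:
  assumes "locally_lipschitz_flux f"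
  shows "continuous_on UNIV f"
proof (rule continuous_at_imp_continuous_on, rule ballI)
  fix a :: real
  define R where "R = \<bar>a\<bar> + 1"
  obtain K where K: "K > 0" "\<And>a b. \<bar>a\<bar> \<le> R \<Longrightarrow> \<bar>b\<bar> \<le> R \<Longrightarrow> norm (f a - f b) \<le> K * \<bar>a - b\<bar>"
    using flux_lipschitz[OF assms, of R] by metis
  have "K-lipschitz_on {-R..R} f"
    using K by (intro lipschitz_onI) (auto simp: dist_norm abs_le_iff)
  then have "continuous_on {-R..R} f" by (rule lipschitz_on_continuous_on)
  then show "isCont f a"
    by (rule continuous_on_interior) (auto simp: R_def)
qed

lemma Linf_norm_AE:
  assumes "Linf_norm M v \<le> ereal B"
  shows "AE x in M. \<bar>v x\<bar> \<le> B"
  using esssup_AE[of "\<lambda>x. ereal \<bar>v x\<bar>" M]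
  by eventually_elim (use assms in \<open>force simp: Linf_norm_def dest: order_trans\<close>)

lemma Linf_obtain_bound:
  assumes "v \<in> Linf M"
  obtains B where "Linf_norm M v \<le> ereal B"
proof -
  have "Linf_norm M v < \<infinity>" using assms by (simp add: Linf_def)
  then show thesis using that by (cases "Linf_norm M v") auto
qed

context finite_measure
begin

lemma Linf_imp_L2:
  assumes "v \<in> Linf M"
  shows "v \<in> L2 M"
proof -
  obtain B where "Linf_norm M v \<le> ereal B" using Linf_obtain_bound[OF assms] .
  then show ?thesis
    using assms Linf_norm_AE[of M v B] by (intro bounded_imp_L2[of _ B]) (auto simp: Linf_def)
qed

lemma flux_L2:
  assumes f: "locally_lipschitz_flux f" and v: "v \<in> Linf M"
  shows "(\<lambda>x. f (v x)) \<in> L2 M"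
proof -
  obtain B where B: "Linf_norm M v \<le> ereal B" using Linf_obtain_bound[OF v] .
  have "compact (f ` {-B..B})"
    using continuous_flux[OF f] by (intro compact_continuous_image) (auto intro: continuous_on_subset)
  then obtain c where c: "\<And>a. a \<in> {-B..B} \<Longrightarrow> norm (f a) \<le> c"
    by (meson bounded_iff compact_imp_bounded imageI)
  have "f \<in> borel_measurable borel" using continuous_flux[OF f] by (rule borel_measurable_continuous_onI)
  then have "(\<lambda>x. f (v x)) \<in> borel_measurable M" using v by (auto simp: Linf_def)
  moreover have "AE x in M. norm (f (v x)) \<le> c"
    using Linf_norm_AE[OF B] by eventually_elim (auto intro!: c simp: abs_le_iff)
  ultimately show ?thesis by (rule bounded_imp_L2)
qed

text \<open>The essential bounds put almost all values into the interval from \<open>-B\<close> to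
  \<open>B\<close>, on which a single Lipschitz constant \<open>K\<close> serves every
  \<open>n\<close>.\<close>

lemma flux_tendsto:
  assumes f: "locally_lipschitz_flux f" and v: "\<And>n. v n \<in> Linf M" "v' \<in> Linf M"
    and bound: "\<forall>\<^sub>F n in sequentially. Linf_norm M (v n) \<le> ereal B" "Linf_norm M v' \<le> ereal B"
    and lim: "(\<lambda>n. L2_norm M (\<lambda>x. v n x - v' x)) \<longlonglongrightarrow> 0"
  shows "(\<lambda>n. L2_norm M (\<lambda>x. f (v n x) - f (v' x))) \<longlonglongrightarrow> 0"
proof -
  obtain K where K: "K > 0" "\<And>a b. \<bar>a\<bar> \<le> B \<Longrightarrow> \<bar>b\<bar> \<le> B \<Longrightarrow> norm (f a - f b) \<le> K * \<bar>a - b\<bar>"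
    using flux_lipschitz[OF f, of B] by metis
  show ?thesis
  proof (rule Lim_null_comparison)
    show "\<forall>\<^sub>F n in sequentially. norm (L2_norm M (\<lambda>x. f (v n x) - f (v' x)))
        \<le> K * L2_norm M (\<lambda>x. v n x - v' x)"
      using bound(1)
    proof eventually_elim
      case (elim n)
      have ae: "AE x in M. norm (f (v n x) - f (v' x)) \<le> K * norm (v n x - v' x)"
        using Linf_norm_AE[OF elim] Linf_norm_AE[OF bound(2)] by eventually_elim (simp add: K)
      have m: "(\<lambda>x. f (v n x) - f (v' x)) \<in> borel_measurable M"
        using L2_diff[OF flux_L2[OF f v(1)] flux_L2[OF f v(2)]] by (simp add: L2_iff_integrable)
      show ?case
        using L2_bound(2)[OF L2_diff[OF Linf_imp_L2[OF v(1)] Linf_imp_L2[OF v(2)]] m _ ae] K(1)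
        by (simp add: L2_norm_nonneg)
    qed
    show "(\<lambda>n. K * L2_norm M (\<lambda>x. v n x - v' x)) \<longlonglongrightarrow> 0"
      using tendsto_mult_right_zero[OF lim] .
  qed
qed

end

subsection \<open>Least-squares functionals\<close>

lemma F_functional_nonneg: "F_functional \<Omega> f v p \<mu> q \<ge> 0"
  by (simp add: F_functional_def)

lemma bdd_below_F_functional: "bdd_below ((\<lambda>(p, \<mu>). F_functional \<Omega> f v p \<mu> q) ` A)"
  using F_functional_nonneg by (intro bdd_belowI[of _ 0]) auto

lemma G_functional_le:
  assumes "p \<in> VC" "\<mu> \<in> VI"
  shows "G_functional \<Omega> f VC VI v q \<le> F_functional \<Omega> f v p \<mu> q"
  unfolding G_functional_def
  using cINF_lower[OF bdd_below_F_functional, of "(p, \<mu>)" "VC \<times> VI"] assms by simp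

lemma G_functional_less_imp_F_less:
  assumes "G_functional \<Omega> f VC VI v q < c" "VC \<noteq> {}" "VI \<noteq> {}"
  obtains p \<mu> where "p \<in> VC" "\<mu> \<in> VI" "F_functional \<Omega> f v p \<mu> q < c"
proof -
  have "\<exists>z\<in>VC \<times> VI. (case z of (p, \<mu>) \<Rightarrow> F_functional \<Omega> f v p \<mu> q) < c"
    using assms unfolding G_functional_def
    by (subst (asm) cINF_less_iff) (auto intro: bdd_below_F_functional)
  then show thesis using that by auto
qed

text \<open>Stated for arbitrary sequences because it is used twice: with the minimizers it treats
  \<open>util\<close>, with the approximants it treats \<open>uhat\<close>. Both get the same value,
  which depends on \<open>q\<close> alone.\<close>

lemma inner_grad_limit_of_F_tendsto_0:
  assumes \<Omega>: "open \<Omega>" "bounded \<Omega>" and fr: "frontier \<Omega> \<subseteq> closure \<Gamma>I \<union> closure \<Gamma>C"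
    and p: "\<And>n. p n \<in> H1_zero \<Omega> \<Gamma>C" and \<mu>: "\<And>n. \<mu> n \<in> H1_zero \<Omega> \<Gamma>I" and q: "q \<in> H1_zero \<Omega> \<Gamma>C"
    and v: "\<And>n. (\<lambda>x. f (v n x)) \<in> L2 (lebesgue_on \<Omega>)" "(\<lambda>x. f (v' x)) \<in> L2 (lebesgue_on \<Omega>)"
    and lim: "(\<lambda>n. L2_norm (lebesgue_on \<Omega>) (\<lambda>x. f (v n x) - f (v' x))) \<longlonglongrightarrow> 0"
    and F: "(\<lambda>n. F_functional \<Omega> f (v n) (p n) (\<mu> n) q) \<longlonglongrightarrow> 0"
    and \<phi>: "\<phi> \<in> H1_zero \<Omega> \<Gamma>C"
  shows "L2_inner (lebesgue_on \<Omega>) (\<lambda>x. f (v' x)) (grad \<Omega> \<phi>)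
    = L2_inner (lebesgue_on \<Omega>) (grad \<Omega> q) (grad \<Omega> \<phi>)"
proof -
  let ?L = "lebesgue_on \<Omega>"
  have H: "w \<in> Hm \<Omega> 1" if "w \<in> H1_zero \<Omega> S" for w S using that by (simp add: H1_zero_def)
  note gp = grad_L2(1)[OF H[OF p]] and g\<mu> = grad_L2(2)[OF H[OF \<mu>]]
  note gq = grad_L2(1)[OF H[OF q]] and g\<phi> = grad_L2(1)[OF H[OF \<phi>]]
  define res where "res n x = f (v n x) - grad \<Omega> (p n) x - grad_perp \<Omega> (\<mu> n) x" for n x
  have res: "res n \<in> L2 ?L" for n
    unfolding res_def by (intro L2_diff v gp g\<mu>)
  \<comment> \<open>Each of the two norms in \<open>F_functional\<close> has its square bounded by
    the functional.\<close>
  have sq0: "a \<longlonglongrightarrow> 0"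
    if "\<And>n. 0 \<le> a n" "\<And>n. (a n)\<^sup>2 \<le> F_functional \<Omega> f (v n) (p n) (\<mu> n) q" for a :: "nat \<Rightarrow> real"
  proof -
    have "(\<lambda>n. (a n)\<^sup>2) \<longlonglongrightarrow> 0"
      by (rule tendsto_sandwich[OF _ _ tendsto_const F]) (use that in auto)
    then have "(\<lambda>n. sqrt ((a n)\<^sup>2)) \<longlonglongrightarrow> sqrt 0" by (rule tendsto_real_sqrt)
    then show ?thesis using that(1) by simp
  qed
  have "(\<lambda>n. L2_norm ?L (res n)) \<longlonglongrightarrow> 0"
    by (rule sq0) (simp_all add: L2_norm_nonneg F_functional_def res_def[abs_def])
  then have "(\<lambda>n. L2_norm ?L (\<lambda>x. res n x - 0)) \<longlonglongrightarrow> 0" by simp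
  from L2_inner_tendsto[OF res _ g\<phi> this]
  have res0: "(\<lambda>n. L2_inner ?L (res n) (grad \<Omega> \<phi>)) \<longlonglongrightarrow> 0"
    by (simp add: L2_iff_integrable L2_inner_def)
  have "(\<lambda>n. L2_norm ?L (\<lambda>x. grad \<Omega> (p n) x - grad \<Omega> q x)) \<longlonglongrightarrow> 0"
    by (rule sq0) (simp_all add: L2_norm_nonneg F_functional_def)
  from tendsto_add[OF res0 L2_inner_tendsto[OF gp gq g\<phi> this]]
  have "(\<lambda>n. L2_inner ?L (res n) (grad \<Omega> \<phi>) + L2_inner ?L (grad \<Omega> (p n)) (grad \<Omega> \<phi>))
      \<longlonglongrightarrow> L2_inner ?L (grad \<Omega> q) (grad \<Omega> \<phi>)" by simp
  \<comment> \<open>\<open>f (v n x)\<close> is the residual plus the two gradients, and the rotated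
    one is orthogonal to \<open>grad \<Omega> \<phi>\<close>.\<close>
  moreover have "L2_inner ?L (res n) (grad \<Omega> \<phi>) + L2_inner ?L (grad \<Omega> (p n)) (grad \<Omega> \<phi>)
      = L2_inner ?L (\<lambda>x. f (v n x)) (grad \<Omega> \<phi>)" for n
    unfolding res_def L2_inner_diff_left[OF L2_diff[OF v(1) gp] g\<mu> g\<phi>]
      L2_inner_diff_left[OF v(1) gp g\<phi>] grad_perp_orthogonal_grad[OF \<Omega> fr \<mu> \<phi>] by simp
  ultimately have "(\<lambda>n. L2_inner ?L (\<lambda>x. f (v n x)) (grad \<Omega> \<phi>))
      \<longlonglongrightarrow> L2_inner ?L (grad \<Omega> q) (grad \<Omega> \<phi>)" by simp
  then show ?thesis using L2_inner_tendsto[OF v g\<phi> lim] LIMSEQ_unique by blast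
qed

section \<open>Passage to the limit along the least-squares minimizers\<close>

theorem theorem5p6:
  fixes \<Omega> \<Gamma>I \<Gamma>C :: "plane set"
    and f :: "real \<Rightarrow> plane"
    and r g uhat q \<psi> util :: "plane \<Rightarrow> real"
    and h :: "nat \<Rightarrow> real"
    and U VC VI :: "nat \<Rightarrow> (plane \<Rightarrow> real) set"
    and uhath qhath \<psi>hath uh :: "nat \<Rightarrow> plane \<Rightarrow> real"
    and C \<beta>u \<beta>q \<beta>\<psi> B :: real
  assumes domain: "open \<Omega>" "bounded \<Omega>" "simply_connected \<Omega>" "lipschitz_boundary \<Omega>"
    and boundary_parts: "frontier \<Omega> = closure \<Gamma>I \<union> closure \<Gamma>C" "\<Gamma>I \<inter> \<Gamma>C = {}"
      "openin (top_of_set (frontier \<Omega>)) \<Gamma>I" "openin (top_of_set (frontier \<Omega>)) \<Gamma>C"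
      "finite (components \<Gamma>I)" "finite (components \<Gamma>C)"
      "emeasure hausdorff1 \<Gamma>I \<noteq> 0" "emeasure hausdorff1 \<Gamma>C \<noteq> 0"
    and data: "r \<in> L2 (lebesgue_on \<Omega>)" "g \<in> Linf (arc_length_on \<Gamma>I)" "locally_lipschitz_flux f"
    and mesh: "\<And>n. h n > 0" "h \<longlonglongrightarrow> 0"
    and spaces: "\<And>n. finite_dim_space (U n)" "\<And>n. U n \<subseteq> Linf (lebesgue_on \<Omega>)"
      "\<And>n. finite_dim_space (VC n)" "\<And>n. VC n \<subseteq> H1_zero \<Omega> \<Gamma>C"
      "\<And>n. finite_dim_space (VI n)" "\<And>n. VI n \<subseteq> H1_zero \<Omega> \<Gamma>I"
    and exact_solution: "weak_solution \<Omega> \<Gamma>I \<Gamma>C f r g uhat"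
    and helmholtz: "q \<in> H1_zero \<Omega> \<Gamma>C" "\<psi> \<in> H1_zero \<Omega> \<Gamma>I"
      "AE p in lebesgue_on \<Omega>. f (uhat p) = grad \<Omega> q p + grad_perp \<Omega> \<psi> p"
    and constants: "C > 0" "\<beta>u > 0" "\<beta>q > 0" "\<beta>\<psi> > 0"
    and regularity: "uhat \<in> Hs \<Omega> \<beta>u" "q \<in> Hs \<Omega> (\<beta>q + 1)" "\<psi> \<in> Hs \<Omega> (\<beta>\<psi> + 1)"
    and approximants: "\<And>n. uhath n \<in> U n" "\<And>n. qhath n \<in> VC n" "\<And>n. \<psi>hath n \<in> VI n"
    and approximation:
      "\<And>n. L2_norm (lebesgue_on \<Omega>) (\<lambda>p. uhath n p - uhat p)
             \<le> C * h n powr \<beta>u * Hs_norm \<Omega> \<beta>u uhat"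
      "\<And>n. L2_norm (lebesgue_on \<Omega>) (\<lambda>p. grad \<Omega> (qhath n) p - grad \<Omega> q p)
             \<le> C * h n powr \<beta>q * Hs_norm \<Omega> (\<beta>q + 1) q"
      "\<And>n. L2_norm (lebesgue_on \<Omega>) (\<lambda>p. grad \<Omega> (\<psi>hath n) p - grad \<Omega> \<psi> p)
             \<le> C * h n powr \<beta>\<psi> * Hs_norm \<Omega> (\<beta>\<psi> + 1) \<psi>"
    and approximants_bounded: "\<exists>M::real. \<forall>n. Linf_norm (lebesgue_on \<Omega>) (uhath n) \<le> ereal M"
    and minimizer:
      "\<And>n. is_arg_min (\<lambda>v. G_functional \<Omega> f (VC n) (VI n) v q) (\<lambda>v. v \<in> U n) (uh n)"
    and limit: "util \<in> Linf (lebesgue_on \<Omega>)"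
      "(\<lambda>n. L2_norm (lebesgue_on \<Omega>) (\<lambda>p. uh n p - util p)) \<longlonglongrightarrow> 0"
    and uniform_bound: "B > 0" "Linf_norm (lebesgue_on \<Omega>) util \<le> ereal B"
      "\<forall>\<^sub>F n in sequentially. Linf_norm (lebesgue_on \<Omega>) (uh n) \<le> ereal B"
  shows "weak_solution \<Omega> \<Gamma>I \<Gamma>C f r g util"
proof -
  let ?L = "lebesgue_on \<Omega>"
  have "\<Omega> \<in> lmeasurable" using domain by (intro bounded_set_imp_lmeasurable) auto
  then interpret finite_measure ?L by (rule finite_measure_lebesgue_on)
  have fr: "frontier \<Omega> \<subseteq> closure \<Gamma>I \<union> closure \<Gamma>C" using boundary_parts(1) by simp
  have uhat: "uhat \<in> Linf ?L" using exact_solution by (simp add: weak_solution_def)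
  have uhath: "uhath n \<in> Linf ?L" for n using approximants(1) spaces(2) by blast
  have uh: "uh n \<in> Linf ?L" for n using minimizer spaces(2) by (fastforce simp: is_arg_min_def)
  have H: "w \<in> Hm \<Omega> 1" if "w \<in> H1_zero \<Omega> S" for w S using that by (simp add: H1_zero_def)
  have qh: "qhath n \<in> H1_zero \<Omega> \<Gamma>C" and \<psi>h: "\<psi>hath n \<in> H1_zero \<Omega> \<Gamma>I" for n
    using approximants spaces by blast+
  note fL2 = flux_L2[OF data(3)]
  \<comment> \<open>The Sobolev norm is a fixed real \<open>N\<close>, so only the positive power of
    the mesh size matters.\<close>
  have rate: "a \<longlonglongrightarrow> 0" if "\<beta> > 0" "\<And>n. 0 \<le> a n" "\<And>n. a n \<le> C * h n powr \<beta> * N"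
    for a :: "nat \<Rightarrow> real" and \<beta> N
  proof (rule tendsto_sandwich[OF _ _ tendsto_const])
    have "(\<lambda>n. h n powr \<beta>) \<longlonglongrightarrow> 0"
      by (rule tendsto_zero_powrI[OF mesh(2) tendsto_const _ that(1)])
         (use mesh(1) in \<open>auto intro: always_eventually less_imp_le\<close>)
    then have "(\<lambda>n. C * h n powr \<beta> * N) \<longlonglongrightarrow> C * 0 * N" by (intro tendsto_intros)
    then show "(\<lambda>n. C * h n powr \<beta> * N) \<longlonglongrightarrow> 0" by simp
  qed (use that in auto)
  have u0: "(\<lambda>n. L2_norm ?L (\<lambda>p. uhath n p - uhat p)) \<longlonglongrightarrow> 0"
    by (rule rate[OF constants(2) L2_norm_nonneg approximation(1)])
  have q0: "(\<lambda>n. L2_norm ?L (\<lambda>p. grad \<Omega> (qhath n) p - grad \<Omega> q p)) \<longlonglongrightarrow> 0"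
    by (rule rate[OF constants(3) L2_norm_nonneg approximation(2)])
  have "(\<lambda>n. L2_norm ?L (\<lambda>p. grad \<Omega> (\<psi>hath n) p - grad \<Omega> \<psi> p)) \<longlonglongrightarrow> 0"
    by (rule rate[OF constants(4) L2_norm_nonneg approximation(3)])
  then have \<psi>0: "(\<lambda>n. L2_norm ?L (\<lambda>p. grad_perp \<Omega> (\<psi>hath n) p - grad_perp \<Omega> \<psi> p)) \<longlonglongrightarrow> 0"
    by (simp add: L2_norm_def norm_grad_perp_diff)
  obtain B1 where B1: "Linf_norm ?L uhat \<le> ereal B1" using Linf_obtain_bound[OF uhat] .
  obtain B2 where B2: "\<And>n. Linf_norm ?L (uhath n) \<le> ereal B2" using approximants_bounded by auto
  have "Linf_norm ?L uhat \<le> ereal (max B1 B2)" "Linf_norm ?L (uhath n) \<le> ereal (max B1 B2)" for n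
    using B1 B2[of n] by (auto intro: order_trans)
  then have f0: "(\<lambda>n. L2_norm ?L (\<lambda>p. f (uhath n p) - f (uhat p))) \<longlonglongrightarrow> 0"
    by (intro flux_tendsto[OF data(3) uhath uhat _ _ u0, of "max B1 B2"]) auto

  define e where "e n = F_functional \<Omega> f (uhath n) (qhath n) (\<psi>hath n) q" for n
  define \<rho> where "\<rho> n x = f (uhath n x) - grad \<Omega> (qhath n) x - grad_perp \<Omega> (\<psi>hath n) x" for n x
  \<comment> \<open>Subtracting the Helmholtz decomposition of \<open>f (uhat x)\<close> leaves the
    residual unchanged almost everywhere and splits it into three differences that each tend to
    0.\<close>
  define \<rho>' where "\<rho>' n x = ((f (uhath n x) - f (uhat x)) - (grad \<Omega> (qhath n) x - grad \<Omega> q x))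
      - (grad_perp \<Omega> (\<psi>hath n) x - grad_perp \<Omega> \<psi> x)" for n x
  note parts = L2_diff[OF fL2[OF uhath] fL2[OF uhat]]
    L2_diff[OF grad_L2(1)[OF H[OF qh]] grad_L2(1)[OF H[OF helmholtz(1)]]]
    L2_diff[OF grad_L2(2)[OF H[OF \<psi>h]] grad_L2(2)[OF H[OF helmholtz(2)]]]
  have \<rho>L2: "\<rho> n \<in> L2 ?L" for n
    unfolding \<rho>_def by (intro L2_diff fL2 uhath grad_L2(1)[OF H[OF qh]] grad_L2(2)[OF H[OF \<psi>h]])
  have \<rho>'L2: "\<rho>' n \<in> L2 ?L" for n
    unfolding \<rho>'_def by (intro L2_diff[OF L2_diff] parts)
  have "L2_norm ?L (\<rho> n) = L2_norm ?L (\<rho>' n)" for n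
  proof (rule L2_norm_cong_AE)
    show "AE x in ?L. norm (\<rho> n x) = norm (\<rho>' n x)"
      using helmholtz(3) by eventually_elim (simp add: \<rho>_def \<rho>'_def algebra_simps)
  qed (use \<rho>L2 \<rho>'L2 in \<open>auto simp: L2_iff_integrable\<close>)
  also have "L2_norm ?L (\<rho>' n) \<le> L2_norm ?L (\<lambda>x. f (uhath n x) - f (uhat x))
      + L2_norm ?L (\<lambda>x. grad \<Omega> (qhath n) x - grad \<Omega> q x)
      + L2_norm ?L (\<lambda>x. grad_perp \<Omega> (\<psi>hath n) x - grad_perp \<Omega> \<psi> x)" (is "_ \<le> ?b n") for n
    unfolding \<rho>'_def
    using L2_norm_triangle_diff[OF L2_diff[OF parts(1,2)] parts(3), of n n n]
      L2_norm_triangle_diff[OF parts(1,2), of n n] by linarith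
  finally have \<rho>_le: "L2_norm ?L (\<rho> n) \<le> ?b n" for n .
  have b0: "?b \<longlonglongrightarrow> 0"
    using tendsto_add[OF tendsto_add[OF f0 q0] \<psi>0] by simp
  have "(\<lambda>n. L2_norm ?L (\<rho> n)) \<longlonglongrightarrow> 0"
    by (rule tendsto_sandwich[OF _ _ tendsto_const b0]) (use \<rho>_le in \<open>auto simp: L2_norm_nonneg\<close>)
  from tendsto_add[OF tendsto_power[OF this, of 2] tendsto_power[OF q0, of 2]]
  have e0: "e \<longlonglongrightarrow> 0"
    by (simp add: e_def[abs_def] F_functional_def \<rho>_def[abs_def])

  \<comment> \<open>\<open>G_functional\<close> is an infimum, so a pair is picked that attains it
    up to a slack of \<open>1 / Suc n\<close>, which vanishes in the limit.\<close>
  have "\<exists>p \<mu>. p \<in> VC n \<and> \<mu> \<in> VI n \<and> F_functional \<Omega> f (uh n) p \<mu> q < e n + 1 / Suc n" for n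
  proof -
    have "G_functional \<Omega> f (VC n) (VI n) (uh n) q \<le> G_functional \<Omega> f (VC n) (VI n) (uhath n) q"
      using minimizer[of n] approximants(1)[of n] by (auto simp: is_arg_min_def not_less)
    also have "\<dots> \<le> e n"
      unfolding e_def by (intro G_functional_le approximants)
    also have "\<dots> < e n + 1 / Suc n" by simp
    finally show ?thesis
      using approximants by (elim G_functional_less_imp_F_less) auto
  qed
  then obtain p \<mu> where p\<mu>: "\<And>n. p n \<in> VC n" "\<And>n. \<mu> n \<in> VI n"
      "\<And>n. F_functional \<Omega> f (uh n) (p n) (\<mu> n) q < e n + 1 / Suc n"
    by metis
  have e1: "(\<lambda>n. e n + 1 / Suc n) \<longlonglongrightarrow> 0"
    using tendsto_add[OF e0 LIMSEQ_inverse_real_of_nat] by (simp add: inverse_eq_divide)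
  have F0: "(\<lambda>n. F_functional \<Omega> f (uh n) (p n) (\<mu> n) q) \<longlonglongrightarrow> 0"
    by (rule tendsto_sandwich[OF _ _ tendsto_const e1])
       (use p\<mu>(3) F_functional_nonneg in \<open>auto intro: always_eventually less_imp_le\<close>)
  have ul: "(\<lambda>n. L2_norm ?L (\<lambda>x. f (uh n x) - f (util x))) \<longlonglongrightarrow> 0"
    by (rule flux_tendsto[OF data(3) uh limit(1) uniform_bound(3,2) limit(2)])

  have Hp: "p n \<in> H1_zero \<Omega> \<Gamma>C" and H\<mu>: "\<mu> n \<in> H1_zero \<Omega> \<Gamma>I" for n
    using p\<mu> spaces by blast+
  have "L2_inner ?L (\<lambda>x. f (util x)) (grad \<Omega> \<phi>) = L2_inner ?L (\<lambda>x. f (uhat x)) (grad \<Omega> \<phi>)"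
    if \<phi>: "\<phi> \<in> H1_zero \<Omega> \<Gamma>C" for \<phi>
  proof -
    have "L2_inner ?L (\<lambda>x. f (util x)) (grad \<Omega> \<phi>) = L2_inner ?L (grad \<Omega> q) (grad \<Omega> \<phi>)"
      by (rule inner_grad_limit_of_F_tendsto_0[OF domain(1,2) fr Hp H\<mu> helmholtz(1)
            fL2[OF uh] fL2[OF limit(1)] ul F0 \<phi>])
    \<comment> \<open>Here the approximants themselves serve as the sequence with vanishing
      functional values.\<close>
    moreover have "L2_inner ?L (\<lambda>x. f (uhat x)) (grad \<Omega> \<phi>) = L2_inner ?L (grad \<Omega> q) (grad \<Omega> \<phi>)"
      by (rule inner_grad_limit_of_F_tendsto_0[OF domain(1,2) fr qh \<psi>h helmholtz(1)
            fL2[OF uhath] fL2[OF uhat] f0 e0[unfolded e_def[abs_def]] \<phi>])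
    ultimately show ?thesis by simp
  qed
  then show ?thesis
    using exact_solution limit(1) by (simp add: weak_solution_def)
qed

end
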